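(* For every $\varepsilon>0$ there is a constant $C_\varepsilon>0$ such that the following holds. Let $\varphi$ be a (nonzero, real-valued) eigenfunction of the Laplacian on $\mathbb{T}^2$ with eigenvalue $E=\lambda^2$ (in the normalization of the context, $E\ge 1$), and let $C$ be a regular arc contained in the nodal set $\mathcal{N}_\varphi$. Then $$w(C)<C_\varepsilon\,\lambda^{-\frac13+\varepsilon}.$$
   Context: $\mathbb{T}^2=\mathbb{R}^2/\mathbb{Z}^2$ is the standard flat torus and $e(t)=\exp(2\pi i t)$. An eigenfunction with eigenvalue $E=\lambda^2$ (the Laplace eigenvalue is actually $4\pi^2E$; $E$ is an integer which is a sum of two squares) is a nonzero real-valued function $\varphi(x)=\sum_{\xi\in\mathbb{Z}^2,\ |\xi|^2=E}a_\xi\, e(x\cdot\xi)$ with $\overline{a_\xi}=a_{-\xi}$. Its nodal set is $\mathcal{N}_\varphi=\{x\in\mathbb{T}^2:\varphi(x)=0\}$. Regular arc: an arc $C\subset\mathbb{T}^2$ is regular if it admits an arc-length parametrization $\gamma:[0,\ell]\to C$, $0<\ell<1$, which is $C^2$ and such that for some $\kappa>0$ one has $\kappa<|\ddot\gamma|<2\kappa$ pointwise and $2\kappa\ell<1$. Width: for a convex curve $C$ in the plane, the width $w(C)$ is the minimal distance between a pair of parallel supporting lines of the curve. A regular arc in $\mathbb{T}^2$ is viewed as a planar (convex) arc by lifting to $\mathbb{R}^2$. *)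

theory Defs
  imports "HOL-Analysis.Analysis"
begin

definition integer_lattice :: "(real ^ 2) set" where
  "integer_lattice = {\<xi>. \<forall>i. \<xi> $ i \<in> \<int>}"

text \<open>The torus \<open>\<real>\<^sup>2 / \<int>\<^sup>2\<close>; the projection from the plane is \<open>abs_torus\<close>.\<close>

quotient_type torus = "real ^ 2" / "\<lambda>x y. x - y \<in> integer_lattice"
proof (rule equivpI)
  show "reflp (\<lambda>x y. x - y \<in> integer_lattice)"
    by (auto simp: reflp_def integer_lattice_def)
  show "symp (\<lambda>x y. x - y \<in> integer_lattice)"
  proof (rule sympI)
    fix x y :: "real ^ 2"
    assume "x - y \<in> integer_lattice"
    then have "- (x - y) $ i \<in> \<int>" for i
      unfolding integer_lattice_def by (metis Ints_minus mem_Collect_eq)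
    then show "y - x \<in> integer_lattice"
      by (simp add: integer_lattice_def)
  qed
  show "transp (\<lambda>x y. x - y \<in> integer_lattice)"
  proof (rule transpI)
    fix x y z :: "real ^ 2"
    assume "x - y \<in> integer_lattice" "y - z \<in> integer_lattice"
    then have "(x - y) $ i + (y - z) $ i \<in> \<int>" for i
      unfolding integer_lattice_def by (metis Ints_add mem_Collect_eq)
    then show "x - z \<in> integer_lattice"
      by (simp add: integer_lattice_def)
  qed
qed

definition e :: "real \<Rightarrow> complex" where
  "e t = exp (2 * of_real pi * \<i> * of_real t)"

definition lattice_circle :: "nat \<Rightarrow> (real ^ 2) set" where
  "lattice_circle E = {\<xi> \<in> integer_lattice. (norm \<xi>)\<^sup>2 = real E}"

lemma finite_lattice_circle: "finite (lattice_circle E)"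
proof -
  let ?Z = "{z :: real. z \<in> \<int> \<and> \<bar>z\<bar> \<le> sqrt (real E)}"
  have fin: "finite ?Z"
    by (rule finite_abs_int_segment)
  have sub: "lattice_circle E \<subseteq> {\<xi>. \<forall>i. \<xi> $ i \<in> ?Z}"
  proof
    fix \<xi> assume \<xi>: "\<xi> \<in> lattice_circle E"
    then have "norm \<xi> = sqrt (real E)"
      by (metis (mono_tags, lifting) lattice_circle_def mem_Collect_eq norm_ge_zero
          real_sqrt_unique)
    then show "\<xi> \<in> {\<xi>. \<forall>i. \<xi> $ i \<in> ?Z}"
      using \<xi> component_le_norm_cart[of \<xi>]
      by (auto simp: lattice_circle_def integer_lattice_def)
  qed
  have "{\<xi> :: real ^ 2. \<forall>i. \<xi> $ i \<in> ?Z} \<subseteq>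
      (\<lambda>(s, t). vector [s, t]) ` (?Z \<times> ?Z)"
  proof
    fix \<xi> :: "real ^ 2" assume \<xi>: "\<xi> \<in> {\<xi>. \<forall>i. \<xi> $ i \<in> ?Z}"
    have "\<xi> = (\<lambda>(s, t). vector [s, t]) (\<xi> $ 1, \<xi> $ 2)"
      by (simp add: vec_eq_iff forall_2)
    moreover have "(\<xi> $ 1, \<xi> $ 2) \<in> ?Z \<times> ?Z"
      using \<xi> by blast
    ultimately show "\<xi> \<in> (\<lambda>(s, t). vector [s, t]) ` (?Z \<times> ?Z)"
      by (rule image_eqI)
  qed
  then show ?thesis
    using sub fin by (meson finite_SigmaI finite_imageI finite_subset)
qed

text \<open>\<open>E\<close> is the eigenvalue in the normalization where the Laplace eigenvalue is
  \<open>4 \<pi>\<^sup>2 E\<close>.\<close>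

definition eigenfunction :: "nat \<Rightarrow> (torus \<Rightarrow> real) \<Rightarrow> bool" where
  "eigenfunction E \<phi> \<longleftrightarrow>
     (\<exists>p. \<phi> p \<noteq> 0) \<and>
     (\<exists>a :: real ^ 2 \<Rightarrow> complex.
        (\<forall>\<xi>\<in>lattice_circle E. cnj (a \<xi>) = a (- \<xi>)) \<and>
        (\<forall>x. complex_of_real (\<phi> (abs_torus x)) = (\<Sum>\<xi>\<in>lattice_circle E. a \<xi> * e (x \<bullet> \<xi>))))"

definition nodal_set :: "(torus \<Rightarrow> real) \<Rightarrow> torus set" where
  "nodal_set \<phi> = {p. \<phi> p = 0}"

text \<open>\<open>\<gamma>\<close> is the lift to the plane of an arc-length parametrization of a regular arc.
  Only its values on \<open>[0, \<ell>]\<close> matter, with one-sided derivatives at the end points.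
  Injectivity, also modulo the lattice, is a consequence: the tangent turns by less than
  \<open>2 \<kappa> \<ell> < 1\<close>, and \<open>\<ell> < 1\<close>.\<close>

definition regular_parametrization :: "real \<Rightarrow> (real \<Rightarrow> real ^ 2) \<Rightarrow> bool" where
  "regular_parametrization l \<gamma> \<longleftrightarrow>
     0 < l \<and> l < 1 \<and>
     (\<exists>\<gamma>' \<gamma>''.
        (\<forall>t\<in>{0..l}. (\<gamma> has_vector_derivative \<gamma>' t) (at t within {0..l})) \<and>
        (\<forall>t\<in>{0..l}. (\<gamma>' has_vector_derivative \<gamma>'' t) (at t within {0..l})) \<and>
        continuous_on {0..l} \<gamma>'' \<and>
        (\<forall>t\<in>{0..l}. norm (\<gamma>' t) = 1) \<and>
        (\<exists>\<kappa>>0. (\<forall>t\<in>{0..l}. \<kappa> < norm (\<gamma>'' t) \<and> norm (\<gamma>'' t) < 2 * \<kappa>) \<and> 2 * \<kappa> * l < 1))"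

text \<open>The planar lift of a regular arc is unique up to translation by the lattice.\<close>

definition regular_lift :: "torus set \<Rightarrow> (real ^ 2) set \<Rightarrow> bool" where
  "regular_lift C \<Gamma> \<longleftrightarrow>
     (\<exists>l \<gamma>. regular_parametrization l \<gamma> \<and> \<Gamma> = \<gamma> ` {0..l} \<and> C = abs_torus ` \<Gamma>)"

definition regular_arc :: "torus set \<Rightarrow> bool" where
  "regular_arc C \<longleftrightarrow> (\<exists>\<Gamma>. regular_lift C \<Gamma>)"

definition supporting_line :: "(real ^ 2) set \<Rightarrow> real ^ 2 \<Rightarrow> (real ^ 2) set \<Rightarrow> bool" where
  "supporting_line \<Gamma> u L \<longleftrightarrow>
     norm u = 1 \<and> (\<exists>c. L = {x. u \<bullet> x = c} \<and> \<Gamma> \<subseteq> {x. u \<bullet> x \<le> c} \<and> \<Gamma> \<inter> L \<noteq> {})"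

text \<open>The two parallel supporting lines are required to have opposite outer normals:
  otherwise a line could be paired with itself and the width would always be \<open>0\<close>.\<close>

definition width :: "(real ^ 2) set \<Rightarrow> real" where
  "width \<Gamma> = Inf {setdist L M | L M. \<exists>u. supporting_line \<Gamma> u L \<and> supporting_line \<Gamma> (- u) M}"

end

theory Submission
  imports Defs "HOL-Computational_Algebra.Primes"
begin

text \<open>Let \<open>\<lambda> = \<surd>E\<close>, and suppose that \<open>\<phi>(x) = \<Sum> a\<^sub>\<xi> e(x \<bullet> \<xi>)\<close> vanishes along an arc \<open>\<gamma>\<close> of length
\<open>l\<close> and curvature about \<open>\<kappa>\<close>. The arc lies in a strip of width \<open>O(\<kappa> l\<^sup>2)\<close> around its initial
tangent, so it suffices to bound the sagitta \<open>\<kappa> l\<^sup>2\<close>. If it exceeded \<open>\<lambda>\<close> to the power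
\<open>-1/3 + \<epsilon>\<close> by a large factor, then the restrictions \<open>t \<mapsto> e(\<gamma>(t) \<bullet> \<xi>)\<close>, \<open>|\<xi>|\<^sup>2 = E\<close>, would be
linearly independent, which contradicts \<open>\<phi> \<circ> \<gamma> = 0\<close>.

Two facts make most of these waves nearly orthogonal. Since the arc is curved, van der
Corput's estimates give \<open>\<integral> e(\<gamma>(t) \<bullet> \<zeta>) dt = O(l (|\<zeta>| \<kappa> l\<^sup>2)\<^sup>-\<^sup>1\<^sup>/\<^sup>2)\<close> on every subinterval
(\<open>wave_integral_le\<close>). And three lattice points on a circle of radius \<open>\<lambda>\<close> span a triangle of
area at least \<open>1/2\<close>, so the product of its sides is at least \<open>2 \<lambda>\<close>; hence each lattice point
on the circle has at most one other within distance \<open>\<lambda>\<^sup>1\<^sup>/\<^sup>3 / 2\<close>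
(\<open>lattice_circle_partner\<close>). Thus the frequencies fall into pairs and singletons, and
frequencies from different clusters have inner products smaller than the length of the arc
by a factor \<open>(\<lambda>\<^sup>1\<^sup>/\<^sup>3 \<kappa> l\<^sup>2)\<^sup>-\<^sup>1\<^sup>/\<^sup>2\<close>, that is, by more than \<open>\<lambda>\<close> to the power \<open>\<epsilon>/2\<close>.
This beats the number of frequencies, which is \<open>O(\<lambda>\<^sup>\<delta>)\<close> for every
\<open>\<delta> > 0\<close> (\<open>card_two_squares_bound\<close>).

The obstacle is inside a pair: if \<open>\<xi>\<close> and \<open>\<eta>\<close> are close, the two waves can be almost parallel
on the arc, so their coefficients are not controlled by the size of their sum. The remedy is
to measure a cluster by a quantity that is comparable to the supremum of
\<open>|a + b e(\<gamma>(t) \<bullet> (\<eta> - \<xi>))|\<close>, namely \<open>|a + b| + |b| min(1, osc)\<close>, where \<open>osc\<close> is the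
variation of the phase difference. This weight is seen by integrating the cluster against one of
its own two frequencies over suitable subintervals (\<open>two_waves_detected\<close>), and it also
bounds the amplitude and its variation, so that integrating the cluster against a
distant frequency still gains the van der Corput factor
(\<open>distant_wave_integral_le\<close>). Applied to the cluster of largest weight, the two estimates
force that weight to be zero, and then all coefficients vanish
(\<open>no_vanishing_wave_sum\<close>).\<close>

section \<open>Oscillatory integrals on an interval\<close>

text \<open>Integration by parts, writing \<open>cis \<theta>\<close> as \<open>(cis \<theta>)' / (\<i> \<theta>')\<close>: the boundary terms are at most
\<open>2 / \<mu>\<close>, and the remaining integrand has modulus \<open>|\<theta>''| / \<theta>'\<^sup>2\<close>.\<close>

lemma first_derivative_test:
  fixes \<theta> \<theta>' \<theta>'' :: "real \<Rightarrow> real"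
  assumes "s \<le> t" and "\<mu> > 0"
    and d1: "\<And>u. u \<in> {s..t} \<Longrightarrow> (\<theta> has_real_derivative \<theta>' u) (at u within {s..t})"
    and d2: "\<And>u. u \<in> {s..t} \<Longrightarrow> (\<theta>' has_real_derivative \<theta>'' u) (at u within {s..t})"
    and cont: "continuous_on {s..t} \<theta>''"
    and low: "\<And>u. u \<in> {s..t} \<Longrightarrow> \<mu> \<le> \<bar>\<theta>' u\<bar>"
  shows "norm (integral {s..t} (\<lambda>u. cis (\<theta> u)))
          \<le> 2 / \<mu> + integral {s..t} (\<lambda>u. \<bar>\<theta>'' u\<bar> / (\<theta>' u)\<^sup>2)"
proof -
  have c0: "continuous_on {s..t} \<theta>" "continuous_on {s..t} \<theta>'"
    using DERIV_continuous_on[of "{s..t}" \<theta>, OF d1] DERIV_continuous_on[of "{s..t}" \<theta>', OF d2] by auto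
  have nz: "\<theta>' u \<noteq> 0" if "u \<in> {s..t}" for u
    using low[OF that] \<open>\<mu> > 0\<close> by auto
  define F where "F u = cis (\<theta> u) / (\<i> * of_real (\<theta>' u))" for u
  define G where "G = (\<lambda>u. - \<i> * (cis (\<theta> u) * of_real (\<theta>'' u / (\<theta>' u)\<^sup>2)))"
  have F': "(F has_vector_derivative (cis (\<theta> u) - G u)) (at u within {s..t})" if u: "u \<in> {s..t}" for u
  proof -
    have a: "((\<lambda>u. cis (\<theta> u)) has_vector_derivative (\<theta>' u *\<^sub>R (\<i> * cis (\<theta> u)))) (at u within {s..t})"
      unfolding has_vector_derivative_def
      by (rule derivative_eq_intros d1[OF u, THEN has_field_derivative_imp_has_derivative] refl)+
        (auto simp: scaleR_conv_of_real algebra_simps)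
    have b: "((\<lambda>u. complex_of_real (inverse (\<theta>' u))) has_vector_derivative
        of_real (- (inverse (\<theta>' u) * \<theta>'' u * inverse (\<theta>' u)))) (at u within {s..t})"
      by (intro has_vector_derivative_of_real DERIV_inverse' d2 u nz)
    have "((\<lambda>u. cis (\<theta> u) * complex_of_real (inverse (\<theta>' u))) has_vector_derivative
       (cis (\<theta> u) * of_real (- (inverse (\<theta>' u) * \<theta>'' u * inverse (\<theta>' u))) + (\<theta>' u *\<^sub>R (\<i> * cis (\<theta> u))) * complex_of_real (inverse (\<theta>' u))))
       (at u within {s..t})" by (rule has_vector_derivative_mult[OF a b])
    then have "((\<lambda>u. -\<i> * (cis (\<theta> u) * complex_of_real (inverse (\<theta>' u)))) has_vector_derivative
       -\<i> * (cis (\<theta> u) * of_real (- (inverse (\<theta>' u) * \<theta>'' u * inverse (\<theta>' u))) + (\<theta>' u *\<^sub>R (\<i> * cis (\<theta> u))) * complex_of_real (inverse (\<theta>' u))))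
       (at u within {s..t})" by (rule has_vector_derivative_mult_right)
    moreover have "-\<i> * (cis (\<theta> u) * of_real (- (inverse (\<theta>' u) * \<theta>'' u * inverse (\<theta>' u))) + (\<theta>' u *\<^sub>R (\<i> * cis (\<theta> u))) * complex_of_real (inverse (\<theta>' u))) = cis (\<theta> u) - G u"
      using nz[OF u] by (simp add: G_def scaleR_conv_of_real field_simps power2_eq_square)
    moreover have "(\<lambda>u. -\<i> * (cis (\<theta> u) * complex_of_real (inverse (\<theta>' u)))) = F"
      by (auto simp: F_def fun_eq_iff divide_inverse mult_ac)
    ultimately show ?thesis by simp
  qed
  have I: "((\<lambda>u. cis (\<theta> u) - G u) has_integral (F t - F s)) {s..t}"
    using \<open>s \<le> t\<close> F' by (intro fundamental_theorem_of_calculus) auto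
  have cc: "continuous_on {s..t} (\<lambda>u. cis (\<theta> u))"
    by (intro continuous_on_cis c0)
  have cG: "continuous_on {s..t} G"
    unfolding G_def using nz by (intro continuous_intros cc cont c0) auto
  have cN: "continuous_on {s..t} (\<lambda>u. \<bar>\<theta>'' u\<bar> / (\<theta>' u)\<^sup>2)"
    using nz by (intro continuous_intros cont c0) auto
  have "integral {s..t} (\<lambda>u. cis (\<theta> u)) - integral {s..t} G = F t - F s"
    using integral_unique[OF I] by (simp add: integral_diff integrable_continuous_interval cc cG)
  then have "integral {s..t} (\<lambda>u. cis (\<theta> u)) = F t - F s + integral {s..t} G"
    by (simp add: algebra_simps)
  moreover have "norm (F u) \<le> 1 / \<mu>" if "u \<in> {s..t}" for u
    using low[OF that] \<open>\<mu> > 0\<close> by (simp add: F_def norm_divide norm_mult frac_le)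
  then have "norm (F t - F s) \<le> 1/\<mu> + 1/\<mu>"
    by (intro order_trans[OF norm_triangle_ineq4] add_mono) (use \<open>s \<le> t\<close> in auto)
  moreover have "norm (integral {s..t} G) \<le> integral {s..t} (\<lambda>u. \<bar>\<theta>'' u\<bar> / (\<theta>' u)\<^sup>2)"
  proof (rule integral_norm_bound_integral)
    show "norm (G u) \<le> \<bar>\<theta>'' u\<bar> / (\<theta>' u)\<^sup>2" for u
      by (simp add: G_def norm_divide norm_mult norm_power)
  qed (intro integrable_continuous_interval cG cN)+
  ultimately show ?thesis
    using norm_triangle_ineq[of "F t - F s" "integral {s..t} G"] by simp
qed

lemma first_derivative_test_bounded:
  fixes \<theta> \<theta>' \<theta>'' :: "real \<Rightarrow> real"
  assumes "s \<le> t" and "\<mu> > 0"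
    and d1: "\<And>u. u \<in> {s..t} \<Longrightarrow> (\<theta> has_real_derivative \<theta>' u) (at u within {s..t})"
    and d2: "\<And>u. u \<in> {s..t} \<Longrightarrow> (\<theta>' has_real_derivative \<theta>'' u) (at u within {s..t})"
    and cont: "continuous_on {s..t} \<theta>''"
    and low: "\<And>u. u \<in> {s..t} \<Longrightarrow> \<mu> \<le> \<bar>\<theta>' u\<bar>"
    and up: "\<And>u. u \<in> {s..t} \<Longrightarrow> \<bar>\<theta>'' u\<bar> \<le> B"
  shows "norm (integral {s..t} (\<lambda>u. cis (\<theta> u))) \<le> 2 / \<mu> + (t - s) * (B / \<mu>\<^sup>2)"
proof -
  have c0: "continuous_on {s..t} \<theta>'"
    using DERIV_continuous_on[of "{s..t}" \<theta>', OF d2] by auto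
  have nz: "\<theta>' u \<noteq> 0" if "u \<in> {s..t}" for u
    using low[OF that] \<open>\<mu> > 0\<close> by auto
  have cN: "continuous_on {s..t} (\<lambda>u. \<bar>\<theta>'' u\<bar> / (\<theta>' u)\<^sup>2)"
    using nz by (intro continuous_intros cont c0) auto
  have "\<bar>\<theta>'' u\<bar> / (\<theta>' u)\<^sup>2 \<le> B / \<mu>\<^sup>2" if u: "u \<in> {s..t}" for u
  proof (rule frac_le)
    show "\<mu>\<^sup>2 \<le> (\<theta>' u)\<^sup>2" using low[OF u] \<open>\<mu> > 0\<close>
      by (metis abs_of_pos power2_abs power_mono less_imp_le)
  qed (use up[OF u] \<open>\<mu> > 0\<close> in auto)
  then have "integral {s..t} (\<lambda>u. \<bar>\<theta>'' u\<bar> / (\<theta>' u)\<^sup>2) \<le> integral {s..t} (\<lambda>u. B / \<mu>\<^sup>2)"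
    by (intro integral_le integrable_continuous_interval cN continuous_intros)
  also have "\<dots> = (t - s) * (B / \<mu>\<^sup>2)" using \<open>s \<le> t\<close> by simp
  finally show ?thesis
    using first_derivative_test[OF assms(1-6)] by simp
qed

text \<open>When \<open>\<theta>'\<close> is monotone, \<open>|\<theta>''| / \<theta>'\<^sup>2\<close> is the derivative of \<open>- 1 / \<theta>'\<close>, so that the remaining
integral is bounded by the values of \<open>1 / \<theta>'\<close> at the end points.\<close>

lemma first_derivative_test_monotone:
  fixes \<theta> \<theta>' \<theta>'' :: "real \<Rightarrow> real"
  assumes "s \<le> t" and "\<mu> > 0"
    and d1: "\<And>u. u \<in> {s..t} \<Longrightarrow> (\<theta> has_real_derivative \<theta>' u) (at u within {s..t})"
    and d2: "\<And>u. u \<in> {s..t} \<Longrightarrow> (\<theta>' has_real_derivative \<theta>'' u) (at u within {s..t})"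
    and cont: "continuous_on {s..t} \<theta>''"
    and low: "\<And>u. u \<in> {s..t} \<Longrightarrow> \<mu> \<le> \<bar>\<theta>' u\<bar>"
    and nonneg: "\<And>u. u \<in> {s..t} \<Longrightarrow> 0 \<le> \<theta>'' u"
  shows "norm (integral {s..t} (\<lambda>u. cis (\<theta> u))) \<le> 4 / \<mu>"
proof -
  have nz: "\<theta>' u \<noteq> 0" if "u \<in> {s..t}" for u
    using low[OF that] \<open>\<mu> > 0\<close> by auto
  have "((\<lambda>u. \<bar>\<theta>'' u\<bar> / (\<theta>' u)\<^sup>2) has_integral (- inverse (\<theta>' t)) - (- inverse (\<theta>' s))) {s..t}"
  proof (rule fundamental_theorem_of_calculus)
    fix u assume u: "u \<in> {s..t}"
    have "((\<lambda>u. - inverse (\<theta>' u)) has_real_derivative - (- (inverse (\<theta>' u) * \<theta>'' u * inverse (\<theta>' u)))) (at u within {s..t})"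
      by (intro DERIV_minus DERIV_inverse' d2 u nz)
    then show "((\<lambda>u. - inverse (\<theta>' u)) has_vector_derivative \<bar>\<theta>'' u\<bar> / (\<theta>' u)\<^sup>2) (at u within {s..t})"
      using nonneg[OF u]
      by (simp add: has_real_derivative_iff_has_vector_derivative power2_eq_square divide_inverse mult_ac)
  qed fact
  then have "integral {s..t} (\<lambda>u. \<bar>\<theta>'' u\<bar> / (\<theta>' u)\<^sup>2) = inverse (\<theta>' s) - inverse (\<theta>' t)"
    by (simp add: integral_unique)
  also have "\<dots> \<le> \<bar>inverse (\<theta>' s)\<bar> + \<bar>inverse (\<theta>' t)\<bar>" by linarith
  also have "\<dots> \<le> inverse \<mu> + inverse \<mu>"
    unfolding abs_inverse using low[of s] low[of t] \<open>s \<le> t\<close> \<open>\<mu> > 0\<close>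
    by (intro add_mono le_imp_inverse_le) auto
  finally show ?thesis
    using first_derivative_test[OF assms(1-6)] by (simp add: divide_inverse)
qed

lemma increment_ge:
  fixes f f' :: "real \<Rightarrow> real"
  assumes der: "\<And>w. w \<in> {s..t} \<Longrightarrow> (f has_real_derivative f' w) (at w within {s..t})"
    and low: "\<And>w. w \<in> {u..v} \<Longrightarrow> m \<le> f' w"
    and "s \<le> u" "u \<le> v" "v \<le> t"
  shows "m * (v - u) \<le> f v - f u"
proof -
  have "(\<lambda>w. f w - m * w) u \<le> (\<lambda>w. f w - m * w) v"
  proof (rule DERIV_nonneg_imp_increasing_open[OF \<open>u \<le> v\<close>])
    fix w assume w: "u < w" "w < v"
    then have "(f has_real_derivative f' w) (at w)"
      using der[of w] assms by (simp add: at_within_Icc_at)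
    then have "((\<lambda>w. f w - m * w) has_real_derivative f' w - m) (at w)"
      by (auto intro!: derivative_eq_intros)
    then show "\<exists>y. ((\<lambda>w. f w - m * w) has_real_derivative y) (at w) \<and> 0 \<le> y"
      using low[of w] w by (intro exI[of _ "f' w - m"]) auto
  next
    show "continuous_on {u..v} (\<lambda>w. f w - m * w)"
      using assms by (intro continuous_intros continuous_on_subset[OF DERIV_continuous_on[OF der]]) auto
  qed
  then show ?thesis by (simp add: algebra_simps)
qed

text \<open>Van der Corput's bound. As \<open>\<theta>'\<close> grows at rate \<open>\<rho>\<close>, it exceeds \<open>\<rho> d\<close> in modulus at distance \<open>d\<close>
from the point where it is smallest. Away from this point the first derivative test applies;
the middle piece contributes at most its length \<open>2 d\<close>; and \<open>d = 2 / \<surd>\<rho>\<close> balances the two.\<close>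

lemma second_derivative_test:
  fixes \<theta> \<theta>' \<theta>'' :: "real \<Rightarrow> real"
  assumes "s \<le> t" and "\<rho> > 0"
    and d1: "\<And>u. u \<in> {s..t} \<Longrightarrow> (\<theta> has_real_derivative \<theta>' u) (at u within {s..t})"
    and d2: "\<And>u. u \<in> {s..t} \<Longrightarrow> (\<theta>' has_real_derivative \<theta>'' u) (at u within {s..t})"
    and cont: "continuous_on {s..t} \<theta>''"
    and low: "\<And>u. u \<in> {s..t} \<Longrightarrow> \<rho> \<le> \<theta>'' u"
  shows "norm (integral {s..t} (\<lambda>u. cis (\<theta> u))) \<le> 8 / sqrt \<rho>"
proof -
  have c0: "continuous_on {s..t} \<theta>" "continuous_on {s..t} \<theta>'"
    using DERIV_continuous_on[of "{s..t}" \<theta>, OF d1] DERIV_continuous_on[of "{s..t}" \<theta>', OF d2] by auto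
  have cc: "continuous_on {s..t} (\<lambda>u. cis (\<theta> u))"
    by (intro continuous_on_cis c0)
  have incr: "\<rho> * (v - u) \<le> \<theta>' v - \<theta>' u" if "s \<le> u" "u \<le> v" "v \<le> t" for u v
    using that low by (intro increment_ge[of s t \<theta>' \<theta>'' u v \<rho>] d2) auto
  have "continuous_on {s..t} (\<lambda>u. \<bar>\<theta>' u\<bar>)" by (intro continuous_intros c0)
  then obtain c where c: "c \<in> {s..t}" "\<And>u. u \<in> {s..t} \<Longrightarrow> \<bar>\<theta>' c\<bar> \<le> \<bar>\<theta>' u\<bar>"
    using continuous_attains_inf[of "{s..t}" "\<lambda>u. \<bar>\<theta>' u\<bar>"] \<open>s \<le> t\<close> by auto
  have right: "\<rho> * (u - c) \<le> \<bar>\<theta>' u\<bar>" if u: "c \<le> u" "u \<le> t" for u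
  proof (cases "\<theta>' c \<ge> 0")
    case True
    then show ?thesis using incr[of c u] c u by auto
  next
    case False
    show ?thesis
    proof (cases "\<theta>' u \<le> 0")
      case True
      then show ?thesis using incr[of c u] c u c(2)[of u] False mult_nonneg_nonneg[of \<rho> "u - c"] \<open>\<rho> > 0\<close> by auto
    next
      case 2: False
      obtain w where w: "c \<le> w" "w \<le> u" "\<theta>' w = 0"
        using IVT'[of \<theta>' c 0 u] False 2 u c continuous_on_subset[OF c0(2), of "{c..u}"] by auto
      then show ?thesis using c(2)[of w] c(1) u False by auto
    qed
  qed
  have left: "\<rho> * (c - u) \<le> \<bar>\<theta>' u\<bar>" if u: "s \<le> u" "u \<le> c" for u
  proof (cases "\<theta>' c \<le> 0")
    case True
    then show ?thesis using incr[of u c] c u by auto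
  next
    case False
    show ?thesis
    proof (cases "\<theta>' u \<ge> 0")
      case True
      then show ?thesis using incr[of u c] c u c(2)[of u] False mult_nonneg_nonneg[of \<rho> "c - u"] \<open>\<rho> > 0\<close> by auto
    next
      case 2: False
      obtain w where w: "u \<le> w" "w \<le> c" "\<theta>' w = 0"
        using IVT'[of \<theta>' u 0 c] False 2 u c continuous_on_subset[OF c0(2), of "{u..c}"] by auto
      then show ?thesis using c(2)[of w] c(1) u False by auto
    qed
  qed
  define d where "d = 2 / sqrt \<rho>"
  have d: "d > 0" "\<rho> * d = 2 * sqrt \<rho>"
    using \<open>\<rho> > 0\<close> by (auto simp: d_def field_simps real_sqrt_mult[symmetric])
  define A where "A = max s (c - d)"
  define B where "B = min t (c + d)"
  have AB: "s \<le> A" "A \<le> c" "c \<le> B" "B \<le> t" "A \<le> B" "B - A \<le> 2 * d"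
    using c d by (auto simp: A_def B_def)
  let ?f = "\<lambda>u. cis (\<theta> u)"
  have sub: "continuous_on {u..v} ?f" if "s \<le> u" "v \<le> t" for u v
    using cc by (rule continuous_on_subset) (use that in auto)
  have part: "norm (integral {u..v} ?f) \<le> 4 / (\<rho> * d)"
    if uv: "s \<le> u" "u \<le> v" "v \<le> t" and far: "\<And>w. w \<in> {u..v} \<Longrightarrow> \<rho> * d \<le> \<bar>\<theta>' w\<bar>" for u v
  proof (rule first_derivative_test_monotone[OF \<open>u \<le> v\<close> _ _ _ _ far])
    show "\<And>w. w \<in> {u..v} \<Longrightarrow> (\<theta> has_real_derivative \<theta>' w) (at w within {u..v})"
      using uv by (auto intro!: DERIV_subset[OF d1])
    show "\<And>w. w \<in> {u..v} \<Longrightarrow> (\<theta>' has_real_derivative \<theta>'' w) (at w within {u..v})"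
      using uv by (auto intro!: DERIV_subset[OF d2])
    show "continuous_on {u..v} \<theta>''" using uv by (auto intro: continuous_on_subset[OF cont])
    show "\<And>w. w \<in> {u..v} \<Longrightarrow> 0 \<le> \<theta>'' w" using uv low \<open>\<rho> > 0\<close> by (meson atLeastAtMost_iff less_imp_le order_trans)
  qed (use d \<open>\<rho> > 0\<close> in auto)
  have split: "integral {s..t} ?f = integral {s..A} ?f + integral {A..B} ?f + integral {B..t} ?f"
  proof -
    have "integral {s..A} ?f + integral {A..t} ?f = integral {s..t} ?f"
      by (rule Henstock_Kurzweil_Integration.integral_combine) (use AB sub in \<open>auto intro: integrable_continuous_interval\<close>)
    moreover have "integral {A..B} ?f + integral {B..t} ?f = integral {A..t} ?f"
      by (rule Henstock_Kurzweil_Integration.integral_combine) (use AB sub in \<open>auto intro: integrable_continuous_interval\<close>)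
    ultimately show ?thesis by (metis add.assoc)
  qed
  have "norm (integral {s..A} ?f) \<le> 4 / (\<rho> * d)"
  proof (cases "c - d \<le> s")
    case True then show ?thesis using d \<open>\<rho> > 0\<close> by (simp add: A_def max_def)
  next
    case False
    show ?thesis
    proof (rule part)
      fix w assume "w \<in> {s..A}"
      then have w: "s \<le> w" "w \<le> c" "d \<le> c - w" using AB False by (auto simp: A_def)
      show "\<rho> * d \<le> \<bar>\<theta>' w\<bar>"
        using left[OF w(1,2)] mult_left_mono[OF w(3), of \<rho>] \<open>\<rho> > 0\<close> by linarith
    qed (use AB in auto)
  qed
  moreover have "norm (integral {B..t} ?f) \<le> 4 / (\<rho> * d)"
  proof (cases "t \<le> c + d")
    case True then show ?thesis using d \<open>\<rho> > 0\<close> by (simp add: B_def min_def)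
  next
    case False
    show ?thesis
    proof (rule part)
      fix w assume "w \<in> {B..t}"
      then have w: "c \<le> w" "w \<le> t" "d \<le> w - c" using AB False by (auto simp: B_def)
      show "\<rho> * d \<le> \<bar>\<theta>' w\<bar>"
        using right[OF w(1,2)] mult_left_mono[OF w(3), of \<rho>] \<open>\<rho> > 0\<close> by linarith
    qed (use AB in auto)
  qed
  moreover have "norm (integral {A..B} ?f) \<le> 1 * (B - A)"
    by (rule integral_bound) (use AB sub in auto)
  ultimately have "norm (integral {s..t} ?f) \<le> 4 / (\<rho> * d) + 1 * (B - A) + 4 / (\<rho> * d)"
    unfolding split by (intro order_trans[OF norm_triangle_ineq] add_mono)
  also have "\<dots> \<le> 4 / (\<rho> * d) + 2 * d + 4 / (\<rho> * d)" using AB(6) by simp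
  also have "\<dots> = 8 / sqrt \<rho>" using \<open>\<rho> > 0\<close> unfolding d(2) by (simp add: d_def field_simps)
  finally show ?thesis .
qed

lemma abs_increment_le:
  fixes f f' :: "real \<Rightarrow> real"
  assumes der: "\<And>w. w \<in> {s..t} \<Longrightarrow> (f has_real_derivative f' w) (at w within {s..t})"
    and le: "\<And>w. w \<in> {u..v} \<Longrightarrow> \<bar>f' w\<bar> \<le> m"
    and "s \<le> u" "u \<le> v" "v \<le> t"
  shows "\<bar>f v - f u\<bar> \<le> m * (v - u)"
proof -
  have m: "- m \<le> f' w" "- m \<le> - f' w" if "w \<in> {u..v}" for w
    using le[OF that] by linarith+
  have "- m * (v - u) \<le> f v - f u"
    by (rule increment_ge[OF der m(1) assms(3-5)])
  moreover have "- m * (v - u) \<le> - f v - - f u"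
    by (rule increment_ge[OF DERIV_minus[OF der] m(2) assms(3-5)])
  ultimately show ?thesis by linarith
qed

text \<open>Subtracting the tangent at \<open>c\<close> and the parabola \<open>m (w - c)\<^sup>2 / 2\<close> leaves a function that
decreases to the left of \<open>c\<close> and increases to the right.\<close>

lemma second_difference_ge:
  fixes f f' f'' :: "real \<Rightarrow> real"
  assumes d1: "\<And>w. w \<in> {s..t} \<Longrightarrow> (f has_real_derivative f' w) (at w within {s..t})"
    and d2: "\<And>w. w \<in> {s..t} \<Longrightarrow> (f' has_real_derivative f'' w) (at w within {s..t})"
    and low: "\<And>w. w \<in> {s..t} \<Longrightarrow> m \<le> f'' w"
    and "s \<le> c - d" "c + d \<le> t" "d \<ge> 0"
  shows "m * d\<^sup>2 \<le> f (c + d) - 2 * f c + f (c - d)"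
proof -
  define g where "g w = f w - f' c * w - m / 2 * (w - c)\<^sup>2" for w
  have g: "(g has_real_derivative f' w - f' c - m * (w - c)) (at w within {s..t})" if "w \<in> {s..t}" for w
    unfolding g_def by (auto intro!: derivative_eq_intros d1 that simp: field_simps)
  have "0 * (c + d - c) \<le> g (c + d) - g c"
  proof (rule increment_ge[OF g])
    fix w assume "w \<in> {c..c + d}"
    then show "0 \<le> f' w - f' c - m * (w - c)"
      using increment_ge[OF d2 low, of c w] assms by auto
  qed (use assms in auto)
  moreover have g': "((\<lambda>w. - g w) has_real_derivative - (f' w - f' c - m * (w - c))) (at w within {s..t})" if "w \<in> {s..t}" for w
    by (intro DERIV_minus g that)
  have "0 * (c - (c - d)) \<le> (- g c) - (- g (c - d))"
  proof (rule increment_ge[OF g'])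
    fix w assume "w \<in> {c - d..c}"
    then show "0 \<le> - (f' w - f' c - m * (w - c))"
      using increment_ge[OF d2 low, of w c] assms by (auto simp: algebra_simps)
  qed (use assms in auto)
  ultimately show ?thesis by (simp add: g_def algebra_simps power2_eq_square)
qed

lemma abs_sin_minus_le: "\<bar>sin x - x\<bar> \<le> x\<^sup>2 / 2" for x :: real
  using Maclaurin_sin_bound[of x 2] by (simp add: numeral_2_eq_2 sin_coeff_def)

lemma norm_cis_minus_one_le: "norm (cis x - 1) \<le> \<bar>x\<bar>"
  using dist_exp_i_1[of x] abs_sin_x_le_abs_x[of "x / 2"] by (simp add: cis_conv_exp)

section \<open>Waves along a slightly curved arc\<close>

text \<open>An arc in coordinates along and across its initial tangent. It turns by so little that the
first coordinate moves at almost unit speed while the second has acceleration between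
\<open>0.9 \<kappa>\<close> and \<open>2 \<kappa>\<close>; the bounds by multiples of \<open>t\<close> make every initial piece of the
arc an instance again, with the same curvature.\<close>

locale curved_arc =
  fixes x x' x'' y y' y'' :: "real \<Rightarrow> real" and l \<kappa> :: real
  assumes l_pos: "0 < l" and \<kappa>_pos: "0 < \<kappa>" and turn: "\<kappa> * l \<le> 1 / 20"
    and x_deriv: "\<And>t. t \<in> {0..l} \<Longrightarrow> (x has_real_derivative x' t) (at t within {0..l})"
    and x'_deriv: "\<And>t. t \<in> {0..l} \<Longrightarrow> (x' has_real_derivative x'' t) (at t within {0..l})"
    and y_deriv: "\<And>t. t \<in> {0..l} \<Longrightarrow> (y has_real_derivative y' t) (at t within {0..l})"
    and y'_deriv: "\<And>t. t \<in> {0..l} \<Longrightarrow> (y' has_real_derivative y'' t) (at t within {0..l})"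
    and cont: "continuous_on {0..l} x''" "continuous_on {0..l} y''"
    and origin: "x 0 = 0" "y 0 = 0"
    and x': "\<And>t. t \<in> {0..l} \<Longrightarrow> 9 / 10 \<le> x' t" "\<And>t. t \<in> {0..l} \<Longrightarrow> x' t \<le> 1"
    and y': "\<And>t. t \<in> {0..l} \<Longrightarrow> \<bar>y' t\<bar> \<le> 2 * \<kappa> * t"
    and x'': "\<And>t. t \<in> {0..l} \<Longrightarrow> \<bar>x'' t\<bar> \<le> 4 * \<kappa>\<^sup>2 * t"
    and y'': "\<And>t. t \<in> {0..l} \<Longrightarrow> 9 / 10 * \<kappa> \<le> y'' t" "\<And>t. t \<in> {0..l} \<Longrightarrow> y'' t \<le> 2 * \<kappa>"
begin

lemma curved_arc_initial:
  assumes "0 < l'" "l' \<le> l"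
  shows "curved_arc x x' x'' y y' y'' l' \<kappa>"
proof -
  have sub: "{0..l'} \<subseteq> {0..l}" using assms by auto
  have "\<kappa> * l' \<le> 1 / 20" using turn mult_left_mono[OF assms(2), of \<kappa>] \<kappa>_pos by linarith
  then show ?thesis
    using assms \<kappa>_pos origin x' y' x'' y'' subsetD[OF sub]
      continuous_on_subset[OF cont(1) sub] continuous_on_subset[OF cont(2) sub]
    by unfold_locales
      (auto intro: DERIV_subset[OF x_deriv sub] DERIV_subset[OF x'_deriv sub]
        DERIV_subset[OF y_deriv sub] DERIV_subset[OF y'_deriv sub])
qed

definition phase :: "real \<Rightarrow> real \<Rightarrow> real \<Rightarrow> real" where
  "phase p q t = p * x t + q * y t"

definition wave :: "real \<Rightarrow> real \<Rightarrow> real \<Rightarrow> complex" where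
  "wave p q t = cis (2 * pi * phase p q t)"

text \<open>Up to a constant factor, the variation over the arc of the phase with frequency \<open>(p, q)\<close>: the
first coordinate ranges over a length about \<open>l\<close> and the second over a length about \<open>\<kappa> l\<^sup>2\<close>.\<close>

definition osc :: "real \<Rightarrow> real \<Rightarrow> real" where
  "osc p q = \<bar>p\<bar> * l + \<bar>q\<bar> * \<kappa> * l\<^sup>2"

lemma osc_nonneg: "0 \<le> osc p q"
  using l_pos \<kappa>_pos by (simp add: osc_def)

lemma phase_0: "phase p q 0 = 0"
  by (simp add: phase_def origin)

lemma phase_deriv:
  assumes "t \<in> {0..l}"
  shows "(phase p q has_real_derivative p * x' t + q * y' t) (at t within {0..l})"
    and "((\<lambda>t. p * x' t + q * y' t) has_real_derivative p * x'' t + q * y'' t) (at t within {0..l})"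
  unfolding phase_def[abs_def]
  by (auto intro!: derivative_eq_intros x_deriv y_deriv x'_deriv y'_deriv assms)

lemma continuous_on_phase: "continuous_on {0..l} (phase p q)"
  by (rule DERIV_continuous_on[OF phase_deriv(1)])

lemma continuous_on_wave: "continuous_on {0..l} (wave p q)"
  unfolding wave_def[abs_def] by (intro continuous_on_cis continuous_intros continuous_on_phase)

lemma wave_integrable:
  assumes "0 \<le> s" "t \<le> l" shows "wave p q integrable_on {s..t}"
  using assms by (intro integrable_continuous_interval continuous_on_subset[OF continuous_on_wave]) auto

lemma norm_wave [simp]: "norm (wave p q t) = 1"
  by (simp add: wave_def)

lemma wave_add: "wave (p + p') (q + q') t = wave p q t * wave p' q' t"
  by (simp add: wave_def phase_def cis_mult algebra_simps)

lemma phase_deriv_le: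
  assumes t: "t \<in> {0..l}"
  shows "l * \<bar>p * x' t + q * y' t\<bar> \<le> 2 * osc p q"
proof -
  have "\<bar>p * x' t\<bar> \<le> \<bar>p\<bar> * 1" using x'[OF t] unfolding abs_mult by (intro mult_left_mono) auto
  moreover have "\<bar>q * y' t\<bar> \<le> \<bar>q\<bar> * (2 * \<kappa> * l)"
    using y'[OF t] t \<kappa>_pos unfolding abs_mult
    by (intro mult_left_mono order_trans[OF y'[OF t]]) auto
  ultimately have "\<bar>p * x' t + q * y' t\<bar> \<le> \<bar>p\<bar> + \<bar>q\<bar> * (2 * \<kappa> * l)" by linarith
  then have "l * \<bar>p * x' t + q * y' t\<bar> \<le> l * (\<bar>p\<bar> + \<bar>q\<bar> * (2 * \<kappa> * l))"
    using l_pos by (intro mult_left_mono) auto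
  also have "\<dots> \<le> 2 * osc p q" using l_pos by (simp add: osc_def algebra_simps power2_eq_square)
  finally show ?thesis .
qed

lemma abs_phase_le:
  assumes t: "t \<in> {0..l}"
  shows "\<bar>phase p q t\<bar> \<le> 2 * osc p q"
proof -
  have *: "- (2 * osc p q) \<le> phase p q t" for p q
  proof -
    have "- (2 * osc p q / l) * (t - 0) \<le> phase p q t - phase p q 0"
    proof (rule increment_ge[OF phase_deriv(1)])
      fix w assume "w \<in> {0..t}"
      then have "l * \<bar>p * x' w + q * y' w\<bar> \<le> 2 * osc p q" using t by (intro phase_deriv_le) auto
      then have "\<bar>p * x' w + q * y' w\<bar> \<le> 2 * osc p q / l" using l_pos by (simp add: field_simps)
      then show "- (2 * osc p q / l) \<le> p * x' w + q * y' w" by linarith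
    qed (use t in auto)
    moreover have "(2 * osc p q / l) * t \<le> (2 * osc p q / l) * l"
      using t l_pos osc_nonneg[of p q] by (intro mult_left_mono) auto
    ultimately show ?thesis using l_pos by (simp add: phase_0)
  qed
  have "phase (- p) (- q) t = - phase p q t" by (simp add: phase_def)
  moreover have "osc (- p) (- q) = osc p q" by (simp add: osc_def)
  ultimately show ?thesis using *[of p q] *[of "- p" "- q"] by linarith
qed

text \<open>Away from the direction normal to the arc, the motion along the tangent dominates and the
phase is monotone. The complementary case, in which the curvature dominates and the
phase is convex or concave, is \<open>flat_phase\<close>.\<close>

lemma steep_phase:
  assumes "10 * \<bar>q\<bar> * \<kappa> * l \<le> \<bar>p\<bar>" and t: "t \<in> {0..l}"
  shows "7 / 10 * \<bar>p\<bar> \<le> sgn p * (p * x' t + q * y' t)"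
proof -
  have "\<bar>p\<bar> * (9/10) \<le> \<bar>p\<bar> * x' t" using x'[OF t] by (intro mult_left_mono) auto
  moreover have "\<bar>sgn p * q * y' t\<bar> \<le> \<bar>q\<bar> * (2 * \<kappa> * l)"
  proof -
    have "\<bar>sgn p * q * y' t\<bar> \<le> \<bar>q\<bar> * \<bar>y' t\<bar>"
      by (auto simp: abs_mult sgn_if)
    also have "\<dots> \<le> \<bar>q\<bar> * (2 * \<kappa> * l)"
      using t \<kappa>_pos by (intro mult_left_mono order_trans[OF y'[OF t]]) auto
    finally show ?thesis .
  qed
  moreover have "sgn p * (p * x' t + q * y' t) = \<bar>p\<bar> * x' t + sgn p * q * y' t"
    by (simp add: algebra_simps abs_sgn)
  ultimately show ?thesis using assms(1) by linarith
qed

lemma phase_second_deriv_le: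
  assumes t: "t \<in> {0..l}"
  shows "l * \<bar>p * x'' t\<bar> \<le> \<bar>p\<bar> / 100" and "\<bar>q * y'' t\<bar> \<le> 2 * \<bar>q\<bar> * \<kappa>"
proof -
  have "l * \<bar>p * x'' t\<bar> \<le> l * (\<bar>p\<bar> * (4 * \<kappa>\<^sup>2 * l))"
    unfolding abs_mult using t l_pos by (intro mult_left_mono order_trans[OF x''[OF t]]) auto
  also have "\<dots> = 4 * \<bar>p\<bar> * (\<kappa> * l)\<^sup>2" by (simp add: power2_eq_square)
  also have "\<dots> \<le> 4 * \<bar>p\<bar> * (1/20)\<^sup>2"
    using turn l_pos \<kappa>_pos by (intro mult_left_mono power_mono) auto
  finally show "l * \<bar>p * x'' t\<bar> \<le> \<bar>p\<bar> / 100" by (simp add: power2_eq_square)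
  have "\<bar>q\<bar> * \<bar>y'' t\<bar> \<le> \<bar>q\<bar> * (2 * \<kappa>)" using y''[OF t] \<kappa>_pos by (intro mult_left_mono) auto
  then show "\<bar>q * y'' t\<bar> \<le> 2 * \<bar>q\<bar> * \<kappa>" by (simp add: abs_mult mult_ac)
qed

lemma flat_phase:
  assumes "\<bar>p\<bar> \<le> 10 * \<bar>q\<bar> * \<kappa> * l" and t: "t \<in> {0..l}"
  shows "8 / 10 * \<bar>q\<bar> * \<kappa> \<le> sgn q * (p * x'' t + q * y'' t)"
proof -
  have "\<bar>q\<bar> * (9/10 * \<kappa>) \<le> \<bar>q\<bar> * y'' t" using y''[OF t] by (intro mult_left_mono) auto
  moreover have "l * \<bar>p * x'' t\<bar> \<le> l * (\<bar>q\<bar> * \<kappa> / 10)"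
    using phase_second_deriv_le(1)[OF t, of p] assms(1) by (simp add: field_simps)
  then have "\<bar>p * x'' t\<bar> \<le> \<bar>q\<bar> * \<kappa> / 10" using l_pos by simp
  moreover have "\<bar>sgn q * (p * x'' t)\<bar> \<le> \<bar>p * x'' t\<bar>" by (auto simp: abs_mult sgn_if)
  moreover have "sgn q * (p * x'' t + q * y'' t) = sgn q * (p * x'' t) + \<bar>q\<bar> * y'' t"
    by (simp add: algebra_simps abs_sgn)
  ultimately show ?thesis by linarith
qed

text \<open>If the frequency is steep, the first derivative test gives the better bound \<open>O(l / osc)\<close>;
otherwise the phase has second derivative of order at least \<open>osc / l\<^sup>2\<close> and the second
derivative test applies.\<close>

lemma wave_integral_le:
  assumes pos: "0 < osc p q" and st: "0 \<le> s" "s \<le> t" "t \<le> l"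
  shows "norm (integral {s..t} (wave p q)) \<le> 12 * l / sqrt (osc p q)"
proof -
  have sub: "u \<in> {0..l}" if "u \<in> {s..t}" for u using that st by auto
  have trivial: "norm (integral {s..t} (wave p q)) \<le> l"
  proof -
    have "norm (integral {s..t} (wave p q)) \<le> 1 * (t - s)"
      using st by (intro integral_bound continuous_on_subset[OF continuous_on_wave]) auto
    then show ?thesis by (rule order_trans) (use st in simp)
  qed
  show ?thesis
  proof (cases "10 * \<bar>q\<bar> * \<kappa> * l \<le> \<bar>p\<bar>")
    case steep: True
    have osc_le: "osc p q \<le> 11 / 10 * \<bar>p\<bar> * l"
      using mult_right_mono[OF steep, of l] l_pos by (simp add: osc_def power2_eq_square algebra_simps)
    have p0: "\<bar>p\<bar> > 0" using pos osc_le l_pos by (cases "p = 0") auto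
    let ?\<mu> = "2 * pi * (7 / 10 * \<bar>p\<bar>)"
    let ?B = "2 * pi * (\<bar>p\<bar> / 100 + \<bar>p\<bar> / 5) / l"
    have "norm (integral {s..t} (\<lambda>u. cis (2 * pi * phase p q u))) \<le> 2 / ?\<mu> + (t - s) * (?B / ?\<mu>\<^sup>2)"
    proof (rule first_derivative_test_bounded[OF \<open>s \<le> t\<close>])
      fix u assume u: "u \<in> {s..t}"
      have "((\<lambda>u. 2 * pi * phase p q u) has_real_derivative 2 * pi * (p * x' u + q * y' u)) (at u within {0..l})"
        by (intro DERIV_cmult phase_deriv sub u)
      then show "((\<lambda>u. 2 * pi * phase p q u) has_real_derivative 2 * pi * (p * x' u + q * y' u)) (at u within {s..t})"
        by (rule DERIV_subset) (use sub in auto)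
      have "((\<lambda>u. 2 * pi * (p * x' u + q * y' u)) has_real_derivative 2 * pi * (p * x'' u + q * y'' u)) (at u within {0..l})"
        by (intro DERIV_cmult phase_deriv sub u)
      then show "((\<lambda>u. 2 * pi * (p * x' u + q * y' u)) has_real_derivative 2 * pi * (p * x'' u + q * y'' u)) (at u within {s..t})"
        by (rule DERIV_subset) (use sub in auto)
      have "\<bar>sgn p * (p * x' u + q * y' u)\<bar> \<le> \<bar>p * x' u + q * y' u\<bar>" by (auto simp: abs_mult sgn_if)
      then have "7 / 10 * \<bar>p\<bar> \<le> \<bar>p * x' u + q * y' u\<bar>" using steep_phase[OF steep sub[OF u]] by linarith
      then show "?\<mu> \<le> \<bar>2 * pi * (p * x' u + q * y' u)\<bar>" by (simp add: abs_mult)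
      have "l * \<bar>q * y'' u\<bar> \<le> l * (2 * \<bar>q\<bar> * \<kappa>)"
        using l_pos by (intro mult_left_mono phase_second_deriv_le sub u) auto
      then have "l * \<bar>q * y'' u\<bar> \<le> \<bar>p\<bar> / 5" using steep by (simp add: algebra_simps)
      moreover have "l * \<bar>p * x'' u + q * y'' u\<bar> \<le> l * \<bar>p * x'' u\<bar> + l * \<bar>q * y'' u\<bar>"
        using l_pos by (simp add: distrib_left[symmetric])
      ultimately have "l * \<bar>p * x'' u + q * y'' u\<bar> \<le> \<bar>p\<bar> / 100 + \<bar>p\<bar> / 5"
        using phase_second_deriv_le(1)[OF sub[OF u], of p] by linarith
      then have "\<bar>p * x'' u + q * y'' u\<bar> \<le> (\<bar>p\<bar> / 100 + \<bar>p\<bar> / 5) / l" using l_pos by (simp add: field_simps)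
      then have "2 * pi * \<bar>p * x'' u + q * y'' u\<bar> \<le> 2 * pi * ((\<bar>p\<bar> / 100 + \<bar>p\<bar> / 5) / l)"
        by (intro mult_left_mono) auto
      then show "\<bar>2 * pi * (p * x'' u + q * y'' u)\<bar> \<le> ?B"
        by (simp add: abs_mult)
    next
      show "continuous_on {s..t} (\<lambda>u. 2 * pi * (p * x'' u + q * y'' u))"
        by (intro continuous_intros continuous_on_subset[OF cont(1)] continuous_on_subset[OF cont(2)]) (use sub in auto)
    qed (use p0 in auto)
    also have "\<dots> \<le> 2 / ?\<mu> + l * (?B / ?\<mu>\<^sup>2)"
      using st l_pos by (intro add_left_mono mult_right_mono) auto
    also have "\<dots> = (2 / (7/10) + (21/100) / (7/10)\<^sup>2) / (2 * pi * \<bar>p\<bar>)"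
      using p0 l_pos by (simp add: field_simps power2_eq_square)
    also have "\<dots> \<le> 4 / (2 * pi * \<bar>p\<bar>)"
      using p0 by (intro divide_right_mono) (auto simp: power2_eq_square)
    also have "\<dots> \<le> 4 / (2 * 2 * \<bar>p\<bar>)"
    proof (rule frac_le)
      show "2 * 2 * \<bar>p\<bar> \<le> 2 * pi * \<bar>p\<bar>" using pi_ge_two by (intro mult_right_mono) simp_all
      show "0 < 2 * 2 * \<bar>p\<bar>" using p0 by simp
    qed simp_all
    also have "\<dots> = 1 / \<bar>p\<bar>" by simp
    finally have bound: "norm (integral {s..t} (wave p q)) \<le> 1 / \<bar>p\<bar>"
      by (simp add: wave_def[abs_def])
    show ?thesis
    proof (cases "osc p q \<le> 1")
      case True
      then have "sqrt (osc p q) \<le> 1" by simp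
      then have "sqrt (osc p q) \<le> 12" by linarith
      then have "l * sqrt (osc p q) \<le> 12 * l" using l_pos by simp
      then have "l \<le> 12 * l / sqrt (osc p q)" using pos by (simp add: field_simps)
      then show ?thesis using trivial by linarith
    next
      case False
      then have "sqrt (osc p q) \<le> osc p q"
        by (intro real_le_lsqrt) (auto simp: power2_eq_square)
      moreover have "0 \<le> \<bar>p\<bar> * l" using l_pos by simp
      ultimately have "sqrt (osc p q) \<le> 12 * (\<bar>p\<bar> * l)" using osc_le by linarith
      then have "sqrt (osc p q) \<le> 12 * l * \<bar>p\<bar>" by (simp add: mult_ac)
      then have "1 / \<bar>p\<bar> \<le> 12 * l / sqrt (osc p q)" using pos p0 by (simp add: field_simps)
      then show ?thesis using bound by linarith
    qed
  next
    case False
    then have flat: "\<bar>p\<bar> \<le> 10 * \<bar>q\<bar> * \<kappa> * l" by simp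
    have osc_le: "osc p q \<le> 11 * (\<bar>q\<bar> * \<kappa> * l\<^sup>2)"
      using mult_right_mono[OF flat, of l] l_pos by (simp add: osc_def power2_eq_square algebra_simps)
    have q0: "\<bar>q\<bar> > 0" using pos osc_le l_pos by (cases "q = 0") auto
    let ?\<rho> = "2 * pi * (8 / 10 * \<bar>q\<bar> * \<kappa>)"
    \<comment> \<open>the sign makes the phase convex; for \<open>q < 0\<close> it replaces the wave by its conjugate\<close>
    let ?c = "2 * pi * sgn q"
    have "norm (integral {s..t} (\<lambda>u. cis (?c * phase p q u))) \<le> 8 / sqrt ?\<rho>"
    proof (rule second_derivative_test[OF \<open>s \<le> t\<close>])
      fix u assume u: "u \<in> {s..t}"
      have "((\<lambda>u. ?c * phase p q u) has_real_derivative ?c * (p * x' u + q * y' u)) (at u within {0..l})"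
        by (intro DERIV_cmult phase_deriv sub u)
      then show "((\<lambda>u. ?c * phase p q u) has_real_derivative ?c * (p * x' u + q * y' u)) (at u within {s..t})"
        by (rule DERIV_subset) (use sub in auto)
      have "((\<lambda>u. ?c * (p * x' u + q * y' u)) has_real_derivative ?c * (p * x'' u + q * y'' u)) (at u within {0..l})"
        by (intro DERIV_cmult phase_deriv sub u)
      then show "((\<lambda>u. ?c * (p * x' u + q * y' u)) has_real_derivative ?c * (p * x'' u + q * y'' u)) (at u within {s..t})"
        by (rule DERIV_subset) (use sub in auto)
      show "?\<rho> \<le> ?c * (p * x'' u + q * y'' u)"
        using mult_left_mono[OF flat_phase[OF flat sub[OF u]], of "2 * pi"] by (simp add: mult_ac)
    next
      show "continuous_on {s..t} (\<lambda>u. ?c * (p * x'' u + q * y'' u))"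
        by (intro continuous_intros continuous_on_subset[OF cont(1)] continuous_on_subset[OF cont(2)]) (use sub in auto)
    qed (use q0 \<kappa>_pos in auto)
    moreover have "norm (integral {s..t} (\<lambda>u. cis (?c * phase p q u))) = norm (integral {s..t} (wave p q))"
    proof (cases "q > 0")
      case True then show ?thesis by (simp add: wave_def[abs_def])
    next
      case False
      then have "sgn q = - 1" using q0 by simp
      then have "(\<lambda>u. cis (?c * phase p q u)) = (\<lambda>u. cnj (wave p q u))"
        by (simp add: wave_def cis_cnj)
      then show ?thesis by (simp add: integral_cnj[symmetric])
    qed
    moreover have "8 / sqrt ?\<rho> \<le> 12 * l / sqrt (osc p q)"
    proof -
      have "8 * sqrt (osc p q) \<le> 8 * sqrt (11 * (\<bar>q\<bar> * \<kappa> * l\<^sup>2))" using osc_le by simp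
      also have "\<dots> = sqrt (8\<^sup>2 * (11 * (\<bar>q\<bar> * \<kappa> * l\<^sup>2)))"
        by (subst real_sqrt_mult) (simp only: real_sqrt_abs abs_numeral)
      also have "\<dots> \<le> sqrt (12\<^sup>2 * (?\<rho> * l\<^sup>2))"
      proof (rule real_sqrt_le_mono)
        have "704 \<le> 230.4 * pi" using pi_approx by simp
        then have "704 * (\<bar>q\<bar> * \<kappa> * l\<^sup>2) \<le> 230.4 * pi * (\<bar>q\<bar> * \<kappa> * l\<^sup>2)"
          using \<kappa>_pos by (intro mult_right_mono) auto
        then show "8\<^sup>2 * (11 * (\<bar>q\<bar> * \<kappa> * l\<^sup>2)) \<le> 12\<^sup>2 * (?\<rho> * l\<^sup>2)" by (simp add: algebra_simps)
      qed
      also have "12\<^sup>2 * (?\<rho> * l\<^sup>2) = (12 * l)\<^sup>2 * ?\<rho>"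
        by (simp only: power_mult_distrib mult_ac)
      also have "sqrt ((12 * l)\<^sup>2 * ?\<rho>) = 12 * l * sqrt ?\<rho>"
        using l_pos by (subst real_sqrt_mult) (simp only: real_sqrt_abs abs_mult abs_numeral abs_of_pos)
      finally have "8 * sqrt (osc p q) \<le> 12 * l * sqrt ?\<rho>" .
      then show ?thesis using pos q0 \<kappa>_pos by (simp add: divide_le_eq pos_le_divide_eq mult_ac)
    qed
    ultimately show ?thesis by linarith
  qed
qed

section \<open>Detecting a pair of waves on subintervals\<close>

text \<open>Either the first difference of the phase between the first and the last third of the arc, or its
second difference over the three thirds, has constant sign and is of the order of the whole
variation. For small variation the imaginary part of the wave agrees with the phase up
to a quadratic error, so the same difference operator is bounded below on it. The
coefficients sum to zero, so that the operator annihilates constants.\<close>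

lemma wave_variation:
  assumes small: "osc p q \<le> 1 / 10 ^ 4"
  shows "\<exists>\<beta> \<gamma> \<sigma>::real. 1 + \<beta> + \<gamma> = 0 \<and> \<bar>\<beta>\<bar> + \<bar>\<gamma>\<bar> \<le> 3 \<and> \<bar>\<sigma>\<bar> \<le> 1 \<and>
    (\<forall>t\<in>{0..l/3}. osc p q / 100 \<le>
       \<sigma> * (Im (wave p q (t + 2 * (l/3))) + \<beta> * Im (wave p q (t + l/3)) + \<gamma> * Im (wave p q t)))"
proof -
  define d where "d = l / 3"
  have d: "d > 0" "l = 3 * d" using l_pos by (auto simp: d_def)
  let ?\<tau> = "\<lambda>t. 2 * pi * phase p q t"
  \<comment> \<open>\<open>13 > 4 \<pi>\<close> and \<open>85 > 13\<^sup>2 / 2\<close>; four such errors stay below the main term because \<open>osc \<le> 10\<^sup>-\<^sup>4\<close>\<close>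
  have err: "\<bar>Im (wave p q t) - ?\<tau> t\<bar> \<le> 85 * (osc p q)\<^sup>2" if "t \<in> {0..l}" for t
  proof -
    have "2 * pi * \<bar>phase p q t\<bar> \<le> 6.5 * (2 * osc p q)"
      using abs_phase_le[OF that] pi_approx by (intro mult_mono) auto
    then have "\<bar>?\<tau> t\<bar> \<le> 13 * osc p q" by (simp add: abs_mult)
    then have "(?\<tau> t)\<^sup>2 \<le> (13 * osc p q)\<^sup>2" by (metis abs_ge_zero power2_abs power_mono)
    then show ?thesis using abs_sin_minus_le[of "?\<tau> t"]
      by (simp add: wave_def power_mult_distrib)
  qed
  have sq: "340 * (osc p q)\<^sup>2 \<le> 34 / 1000 * osc p q"
    using mult_right_mono[OF small osc_nonneg[of p q]] by (simp add: power2_eq_square)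
  have *: "osc p q / 100 \<le> \<sigma> * (Im (wave p q (t + 2 * d)) + \<beta> * Im (wave p q (t + d)) + \<gamma> * Im (wave p q t))"
    if t: "t \<in> {0..d}" and c: "\<bar>\<beta>\<bar> + \<bar>\<gamma>\<bar> \<le> 3" and \<sigma>: "\<bar>\<sigma>\<bar> \<le> 1"
      and main: "osc p q * 8 / 1000 \<le> \<sigma> * (phase p q (t + 2 * d) + \<beta> * phase p q (t + d) + \<gamma> * phase p q t)"
    for t \<beta> \<gamma> \<sigma>
  proof -
    define dev where "dev t = Im (wave p q t) - ?\<tau> t" for t
    let ?E = "85 * (osc p q)\<^sup>2"
    have "\<bar>dev (t + 2 * d)\<bar> \<le> ?E" "\<bar>dev (t + d)\<bar> \<le> ?E" "\<bar>dev t\<bar> \<le> ?E"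
      unfolding dev_def using t d by (intro err; auto)+
    then have "\<bar>dev (t + 2 * d)\<bar> + \<bar>\<beta>\<bar> * \<bar>dev (t + d)\<bar> + \<bar>\<gamma>\<bar> * \<bar>dev t\<bar> \<le> ?E + \<bar>\<beta>\<bar> * ?E + \<bar>\<gamma>\<bar> * ?E"
      by (intro add_mono mult_left_mono) auto
    also have "\<dots> \<le> 4 * ?E"
      using mult_right_mono[OF c, of ?E] by (simp add: algebra_simps)
    finally have "\<bar>dev (t + 2 * d) + \<beta> * dev (t + d) + \<gamma> * dev t\<bar> \<le> 4 * ?E"
      using abs_triangle_ineq[of "dev (t + 2 * d) + \<beta> * dev (t + d)" "\<gamma> * dev t"]
        abs_triangle_ineq[of "dev (t + 2 * d)" "\<beta> * dev (t + d)"] by (simp add: abs_mult)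
    then have "\<bar>\<sigma>\<bar> * \<bar>dev (t + 2 * d) + \<beta> * dev (t + d) + \<gamma> * dev t\<bar> \<le> 1 * (4 * ?E)"
      using \<sigma> by (intro mult_mono) auto
    then have "\<bar>\<sigma> * (dev (t + 2 * d) + \<beta> * dev (t + d) + \<gamma> * dev t)\<bar> \<le> 34 / 1000 * osc p q"
      using sq by (simp add: abs_mult)
    moreover have "2 * pi * (osc p q * 8 / 1000)
      \<le> 2 * pi * (\<sigma> * (phase p q (t + 2 * d) + \<beta> * phase p q (t + d) + \<gamma> * phase p q t))"
      using main by (intro mult_left_mono) auto
    moreover have "6 * (osc p q * 8 / 1000) \<le> 2 * pi * (osc p q * 8 / 1000)"
      using pi_approx osc_nonneg[of p q] by (intro mult_right_mono) auto
    moreover have "\<sigma> * (Im (wave p q (t + 2 * d)) + \<beta> * Im (wave p q (t + d)) + \<gamma> * Im (wave p q t))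
      = 2 * pi * (\<sigma> * (phase p q (t + 2 * d) + \<beta> * phase p q (t + d) + \<gamma> * phase p q t))
        + \<sigma> * (dev (t + 2 * d) + \<beta> * dev (t + d) + \<gamma> * dev t)"
      by (simp add: dev_def algebra_simps)
    ultimately show ?thesis using osc_nonneg[of p q] by linarith
  qed
  show ?thesis
  proof (cases "10 * \<bar>q\<bar> * \<kappa> * l \<le> \<bar>p\<bar>")
    case steep: True
    have osc_le: "osc p q \<le> 11 / 10 * \<bar>p\<bar> * l"
      using mult_right_mono[OF steep, of l] l_pos by (simp add: osc_def power2_eq_square algebra_simps)
    have "osc p q / 100 \<le> sgn p * (Im (wave p q (t + 2 * d)) + 0 * Im (wave p q (t + d)) + (- 1) * Im (wave p q t))"
      if t: "t \<in> {0..d}" for t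
    proof (rule *[OF t])
      have "7 / 10 * \<bar>p\<bar> * (t + 2 * d - t) \<le> sgn p * phase p q (t + 2 * d) - sgn p * phase p q t"
        using t d steep_phase[OF steep] by (intro increment_ge[OF DERIV_cmult[OF phase_deriv(1)]]) auto
      then have "7 / 5 * (\<bar>p\<bar> * d) \<le> sgn p * (phase p q (t + 2 * d) + 0 * phase p q (t + d) + - 1 * phase p q t)"
        by (simp add: algebra_simps)
      moreover have "osc p q \<le> 33 / 10 * (\<bar>p\<bar> * d)" using osc_le by (simp add: d(2))
      moreover have "0 \<le> \<bar>p\<bar> * d" using d by simp
      ultimately show "osc p q * 8 / 1000 \<le> sgn p * (phase p q (t + 2 * d) + 0 * phase p q (t + d) + - 1 * phase p q t)"
        by linarith
    qed (auto simp: sgn_if)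
    then show ?thesis
      by (intro exI[of _ 0] exI[of _ "- 1"] exI[of _ "sgn p"]) (auto simp: d_def sgn_if)
  next
    case False
    then have flat: "\<bar>p\<bar> \<le> 10 * \<bar>q\<bar> * \<kappa> * l" by simp
    have osc_le: "osc p q \<le> 11 * (\<bar>q\<bar> * \<kappa> * l\<^sup>2)"
      using mult_right_mono[OF flat, of l] l_pos by (simp add: osc_def power2_eq_square algebra_simps)
    have "osc p q / 100 \<le> sgn q * (Im (wave p q (t + 2 * d)) + (- 2) * Im (wave p q (t + d)) + 1 * Im (wave p q t))"
      if t: "t \<in> {0..d}" for t
    proof (rule *[OF t])
      have second: "8 / 10 * \<bar>q\<bar> * \<kappa> * d\<^sup>2 \<le> sgn q * phase p q ((t + d) + d) - 2 * (sgn q * phase p q (t + d)) + sgn q * phase p q ((t + d) - d)"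
        using t d flat_phase[OF flat]
        by (intro second_difference_ge[OF DERIV_cmult[OF phase_deriv(1)] DERIV_cmult[OF phase_deriv(2)]]) auto
      have "osc p q \<le> 99 * (\<bar>q\<bar> * \<kappa> * d\<^sup>2)"
        using osc_le by (simp add: d(2) power_mult_distrib)
      moreover have "0 \<le> \<bar>q\<bar> * \<kappa> * d\<^sup>2" using \<kappa>_pos by simp
      ultimately have "osc p q * 8 / 1000 \<le> 8 / 10 * \<bar>q\<bar> * \<kappa> * d\<^sup>2"
        by linarith
      with second show "osc p q * 8 / 1000 \<le> sgn q * (phase p q (t + 2 * d) + - 2 * phase p q (t + d) + 1 * phase p q t)"
        by (simp add: algebra_simps)
    qed (auto simp: sgn_if)
    then show ?thesis
      by (intro exI[of _ "- 2"] exI[of _ 1] exI[of _ "sgn q"]) (auto simp: d_def sgn_if)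
  qed
qed

lemma norm_wave_minus_one_le:
  assumes "t \<in> {0..l}"
  shows "norm (wave p q t - 1) \<le> 13 * osc p q"
proof -
  have "2 * pi * \<bar>phase p q t\<bar> \<le> 6.5 * (2 * osc p q)"
    using abs_phase_le[OF assms] pi_approx by (intro mult_mono) auto
  then show ?thesis
    using norm_cis_minus_one_le[of "2 * pi * phase p q t"] by (simp add: wave_def abs_mult)
qed

text \<open>Applying the difference operator of \<open>wave_variation\<close> to \<open>a + b wave\<close> removes the constant and
leaves \<open>b\<close> times something of order \<open>osc\<close>. Once \<open>|b| osc\<close> is under control,
\<open>a + b wave\<close> differs little from \<open>a + b\<close>, which is then bounded by one of the integrals.\<close>

lemma two_waves_detected_small:
  fixes a b :: complex
  assumes small: "osc p q \<le> 1 / 10 ^ 4"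
    and test: "\<And>s t. 0 \<le> s \<Longrightarrow> s \<le> t \<Longrightarrow> t \<le> l \<Longrightarrow> norm (integral {s..t} (\<lambda>u. a + b * wave p q u)) \<le> \<mu> * l"
  shows "norm b * osc p q \<le> 1200 * \<mu>" and "norm (a + b) \<le> 16000 * \<mu>"
proof -
  define d where "d = l / 3"
  have d: "d > 0" "l = 3 * d" using l_pos by (auto simp: d_def)
  let ?W = "wave p q"
  let ?g = "\<lambda>u. a + b * ?W u"
  obtain \<beta> \<gamma> \<sigma> :: real where c: "1 + \<beta> + \<gamma> = 0" "\<bar>\<beta>\<bar> + \<bar>\<gamma>\<bar> \<le> 3" "\<bar>\<sigma>\<bar> \<le> 1"
    and var: "\<And>t. t \<in> {0..d} \<Longrightarrow> osc p q / 100 \<le> \<sigma> * (Im (?W (t + 2 * d)) + \<beta> * Im (?W (t + d)) + \<gamma> * Im (?W t))"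
    using wave_variation[OF small] unfolding d_def by blast
  have g_int: "?g integrable_on {s..t}" if "0 \<le> s" "t \<le> l" for s t
    using that by (intro integrable_continuous_interval continuous_intros continuous_on_subset[OF continuous_on_wave]) auto
  have shift: "((\<lambda>u. f (u + c)) has_integral integral {c..c + d} f) {0..d}"
    if "f integrable_on {c..c + d}" for f :: "real \<Rightarrow> complex" and c
    using has_integral_shift_real_ivl[OF integrable_integral[OF that], of c] by simp
  define V where "V u = ?W (u + 2 * d) + of_real \<beta> * ?W (u + d) + of_real \<gamma> * ?W u" for u
  define J where "J = integral {0..d} V"
  have W2: "((\<lambda>u. ?W (u + 2 * d)) has_integral integral {2 * d..2 * d + d} ?W) {0..d}"
    and W1: "((\<lambda>u. ?W (u + d)) has_integral integral {d..d + d} ?W) {0..d}"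
    and W0: "(?W has_integral integral {0..d} ?W) {0..d}"
    using d by (intro shift integrable_integral wave_integrable; simp)+
  have "V integrable_on {0..d}"
    unfolding V_def[abs_def] using W2 W1 W0
    by (intro integrable_add integrable_on_mult_right) (auto simp: integrable_on_def)
  then have VJ: "(V has_integral J) {0..d}" unfolding J_def by (rule integrable_integral)
  have I2: "((\<lambda>u. ?g (u + 2 * d)) has_integral integral {2 * d..2 * d + d} ?g) {0..d}"
    and I1: "((\<lambda>u. ?g (u + d)) has_integral integral {d..d + d} ?g) {0..d}"
    and I0: "(?g has_integral integral {0..d} ?g) {0..d}"
    using d by (intro shift integrable_integral g_int; simp)+
  have "((\<lambda>u. ?g (u + 2 * d) + of_real \<beta> * ?g (u + d) + of_real \<gamma> * ?g u) has_integral
      integral {2 * d..2 * d + d} ?g + of_real \<beta> * integral {d..d + d} ?g + of_real \<gamma> * integral {0..d} ?g) {0..d}"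
    by (intro has_integral_add has_integral_mult_right I2 I1 I0)
  moreover have "?g (u + 2 * d) + of_real \<beta> * ?g (u + d) + of_real \<gamma> * ?g u = b * V u" for u
  proof -
    have "a + of_real \<beta> * a + of_real \<gamma> * a = of_real (1 + \<beta> + \<gamma>) * a" by (simp add: algebra_simps)
    then have "a + of_real \<beta> * a + of_real \<gamma> * a = 0" by (simp add: c)
    then show ?thesis by (simp add: V_def algebra_simps)
  qed
  ultimately have "((\<lambda>u. b * V u) has_integral
      integral {2 * d..2 * d + d} ?g + of_real \<beta> * integral {d..d + d} ?g + of_real \<gamma> * integral {0..d} ?g) {0..d}"
    by simp
  then have bJ: "b * J = integral {2 * d..2 * d + d} ?g + of_real \<beta> * integral {d..d + d} ?g + of_real \<gamma> * integral {0..d} ?g"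
    using has_integral_mult_right[OF VJ, of b] has_integral_unique by blast
  have t2: "norm (integral {2 * d..2 * d + d} ?g) \<le> \<mu> * l"
    by (rule test) (use d in simp_all)
  have t1: "norm (integral {d..d + d} ?g) \<le> \<mu> * l"
    by (rule test) (use d in simp_all)
  have t0: "norm (integral {0..d} ?g) \<le> \<mu> * l"
    by (rule test) (use d in simp_all)
  have \<mu>0: "0 \<le> \<mu> * l" using t0 norm_ge_zero order_trans by blast
  have "norm (b * J) \<le> \<mu> * l + \<bar>\<beta>\<bar> * (\<mu> * l) + \<bar>\<gamma>\<bar> * (\<mu> * l)"
  proof -
    have "norm (z\<^sub>2 + of_real \<beta> * z\<^sub>1 + of_real \<gamma> * z\<^sub>0) \<le> m + \<bar>\<beta>\<bar> * m + \<bar>\<gamma>\<bar> * m"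
      if "norm z\<^sub>2 \<le> m" "norm z\<^sub>1 \<le> m" "norm z\<^sub>0 \<le> m" for z\<^sub>2 z\<^sub>1 z\<^sub>0 :: complex and m
      using that by (intro order_trans[OF norm_triangle_ineq] add_mono) (auto simp: norm_mult intro!: mult_left_mono)
    then show ?thesis unfolding bJ using t2 t1 t0 by blast
  qed
  also have "\<dots> \<le> 4 * (\<mu> * l)"
    using mult_right_mono[OF c(2) \<mu>0] by (simp add: algebra_simps)
  finally have up: "norm b * norm J \<le> 12 * \<mu> * d" by (simp add: norm_mult d)
  have "((\<lambda>u. Im (V u)) has_integral Im J) {0..d}"
    using has_integral_linear[OF VJ bounded_linear_Im] by (simp add: o_def)
  then have ImV: "((\<lambda>u. \<sigma> * Im (V u)) has_integral \<sigma> * Im J) {0..d}" by (rule has_integral_mult_right)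
  have low: "((\<lambda>u. osc p q / 100) has_integral (d - 0) *\<^sub>R (osc p q / 100)) {0..d}"
    using has_integral_const_real[of "osc p q / 100" 0 d] d by simp
  have "(d - 0) *\<^sub>R (osc p q / 100) \<le> \<sigma> * Im J"
    by (rule has_integral_le[OF low ImV]) (use var in \<open>auto simp: V_def\<close>)
  also have "\<dots> \<le> \<bar>\<sigma>\<bar> * \<bar>Im J\<bar>" by (metis abs_ge_self abs_mult)
  also have "\<dots> \<le> 1 * norm J"
    using c(3) abs_Im_le_cmod[of J] by (intro mult_mono) auto
  finally have "norm b * (d * (osc p q / 100)) \<le> norm b * norm J" by (intro mult_left_mono) auto
  then have "d * (norm b * osc p q) \<le> d * (1200 * \<mu>)" using up by (simp add: algebra_simps)
  then show b: "norm b * osc p q \<le> 1200 * \<mu>" using d by simp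
  have K: "(\<lambda>u. ?W u - 1) integrable_on {0..d}" using W0 by (intro integrable_diff) (auto simp: integrable_on_def)
  have sub: "{0..d} \<subseteq> {0..l}" using d by auto
  have "norm (integral {0..d} (\<lambda>u. ?W u - 1)) \<le> (13 * osc p q) * (d - 0)"
  proof (rule integral_bound)
    show "continuous_on {0..d} (\<lambda>u. ?W u - 1)"
      by (intro continuous_intros continuous_on_subset[OF continuous_on_wave sub])
  qed (use d(1) sub norm_wave_minus_one_le in auto)
  moreover have "((\<lambda>u. (a + b) + b * (?W u - 1)) has_integral
      (d - 0) *\<^sub>R (a + b) + b * integral {0..d} (\<lambda>u. ?W u - 1)) {0..d}"
    using has_integral_const_real[of "a + b" 0 d] d
    by (intro has_integral_add has_integral_mult_right integrable_integral K) simp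
  then have "(?g has_integral of_real d * (a + b) + b * integral {0..d} (\<lambda>u. ?W u - 1)) {0..d}"
    by (simp add: algebra_simps scaleR_conv_of_real)
  then have "integral {0..d} ?g = of_real d * (a + b) + b * integral {0..d} (\<lambda>u. ?W u - 1)"
    by (rule integral_unique)
  then have "of_real d * (a + b) = integral {0..d} ?g - b * integral {0..d} (\<lambda>u. ?W u - 1)" by simp
  then have "d * norm (a + b) \<le> norm (integral {0..d} ?g) + norm b * norm (integral {0..d} (\<lambda>u. ?W u - 1))"
    using d norm_triangle_ineq4[of "integral {0..d} ?g" "b * integral {0..d} (\<lambda>u. ?W u - 1)"]
    by (metis abs_of_pos norm_mult norm_of_real)
  ultimately have "d * norm (a + b) \<le> \<mu> * l + norm b * ((13 * osc p q) * (d - 0))"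
    using t0 by (elim order_trans) (intro add_mono mult_left_mono norm_ge_zero)
  also have "\<dots> = d * (3 * \<mu> + 13 * (norm b * osc p q))" by (simp add: d algebra_simps)
  finally have "norm (a + b) \<le> 3 * \<mu> + 13 * (norm b * osc p q)" using d by simp
  moreover have "\<mu> \<ge> 0" using \<mu>0 l_pos by (simp add: zero_le_mult_iff)
  ultimately show "norm (a + b) \<le> 16000 * \<mu>" using b by linarith
qed

text \<open>A proxy for the supremum over the arc of \<open>|a + b wave|\<close>: the value at the starting point and the
distance that the second term can move from there. It can be far smaller than \<open>|a| + |b|\<close> when the
wave is almost constant.\<close>

definition weight :: "complex \<Rightarrow> complex \<Rightarrow> real \<Rightarrow> real \<Rightarrow> real" where
  "weight a b p q = norm (a + b) + norm b * min 1 (osc p q)"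

lemma weight_nonneg: "0 \<le> weight a b p q"
  by (simp add: weight_def osc_nonneg)

text \<open>For moderate variation, passing to a short initial piece of the arc makes the variation small
without losing more than a constant factor, and \<open>two_waves_detected_small\<close> applies there.
For large variation the two waves are nearly orthogonal on the whole arc, and integrating against
each of them recovers both coefficients. Only the absoluteness of the constant matters.\<close>

lemma two_waves_detected:
  fixes a b :: complex
  assumes test: "\<And>s t. 0 \<le> s \<Longrightarrow> s \<le> t \<Longrightarrow> t \<le> l \<Longrightarrow> norm (integral {s..t} (\<lambda>u. a + b * wave p q u)) \<le> \<mu> * l"
    and test': "norm (integral {0..l} (\<lambda>u. a * wave (- p) (- q) u + b)) \<le> \<mu> * l"
  shows "weight a b p q \<le> 10 ^ 25 * \<mu>"
proof -
  have "0 \<le> \<mu> * l" using test' norm_ge_zero order_trans by blast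
  then have \<mu>0: "0 \<le> \<mu>" using l_pos by (simp add: zero_le_mult_iff)
  show ?thesis
  proof (cases "osc p q \<le> 576")
    case True
    \<comment> \<open>\<open>576 / 10\<^sup>7\<close> is below the threshold \<open>10\<^sup>-\<^sup>4\<close> of the case of small variation\<close>
    define r where "r = l / 10 ^ 7"
    have r: "0 < r" "r \<le> l" "l = 10 ^ 7 * r" using l_pos by (auto simp: r_def)
    interpret S: curved_arc x x' x'' y y' y'' r \<kappa> by (rule curved_arc_initial) fact+
    have up: "S.osc p q \<le> osc p q / 10 ^ 7"
      unfolding S.osc_def osc_def using r \<kappa>_pos mult_nonneg_nonneg[of "\<bar>q\<bar>" "\<kappa> * r\<^sup>2"]
      by (simp add: power_mult_distrib)
    have low: "osc p q \<le> 10 ^ 14 * S.osc p q"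
      unfolding S.osc_def osc_def using r \<kappa>_pos mult_nonneg_nonneg[of "\<bar>p\<bar>" r]
      by (simp add: power_mult_distrib)
    have small: "S.osc p q \<le> 1 / 10 ^ 4" using up True by simp
    have t: "norm (integral {s..t} (\<lambda>u. a + b * S.wave p q u)) \<le> (10 ^ 7 * \<mu>) * r"
      if "0 \<le> s" "s \<le> t" "t \<le> r" for s t
      using test[of s t] that r by (simp add: mult_ac)
    have "norm b * min 1 (osc p q) \<le> norm b * (10 ^ 14 * S.osc p q)"
      using low by (intro mult_left_mono) auto
    also have "\<dots> \<le> 10 ^ 14 * (1200 * (10 ^ 7 * \<mu>))"
      using S.two_waves_detected_small(1)[OF small t] by simp
    finally show ?thesis
      using S.two_waves_detected_small(2)[OF small t] \<mu>0 by (simp add: weight_def)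
  next
    case False
    then have s24: "24 \<le> sqrt (osc p q)" by (intro real_le_rsqrt) simp
    \<comment> \<open>\<open>12 / \<surd>576 = 1/2\<close>, so the Gram matrix of the two waves is diagonally dominant\<close>
    have half: "norm (integral {0..l} (wave p' q')) \<le> l / 2" if "osc p' q' = osc p q" for p' q'
    proof -
      have "norm (integral {0..l} (wave p' q')) \<le> 12 * l / sqrt (osc p q)"
        using wave_integral_le[of p' q' 0 l] that False l_pos by simp
      also have "\<dots> \<le> 12 * l / 24" using s24 l_pos by (intro frac_le) auto
      finally show ?thesis by simp
    qed
    have W: "wave p' q' integrable_on {0..l}" for p' q' by (intro wave_integrable) auto
    have bound: "norm c \<le> \<mu> + norm c' / 2"
      if "norm (of_real l * c + c' * A) \<le> \<mu> * l" "norm A \<le> l / 2" for c c' A :: complex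
    proof -
      have "l * norm c \<le> norm (of_real l * c + c' * A) + norm (c' * A)"
        using norm_triangle_ineq4[of "of_real l * c + c' * A" "c' * A"] l_pos by (simp add: norm_mult)
      also have "\<dots> \<le> \<mu> * l + norm c' * (l / 2)"
        unfolding norm_mult using that by (intro add_mono mult_left_mono norm_ge_zero) (simp_all only: norm_mult)
      finally have "l * norm c \<le> l * (\<mu> + norm c' / 2)" by (simp add: algebra_simps)
      then show ?thesis using l_pos by simp
    qed
    have I: "integral {0..l} (\<lambda>u. c + c' * wave p' q' u) = of_real l * c + c' * integral {0..l} (wave p' q')"
      for c c' p' q'
      using has_integral_const_real[of c 0 l] l_pos
      by (intro integral_unique has_integral_add has_integral_mult_right integrable_integral W)
        (simp add: scaleR_conv_of_real)
    have "norm a \<le> \<mu> + norm b / 2"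
      by (rule bound[OF _ half[of p q]]) (use test[of 0 l] l_pos I[of a b p q] in auto)
    moreover have "norm b \<le> \<mu> + norm a / 2"
      by (rule bound[OF _ half[of "- p" "- q"]])
        (use test' I[of b a "- p" "- q"] in \<open>auto simp: osc_def add.commute\<close>)
    moreover have "norm b * min 1 (osc p q) \<le> norm b" by (simp add: mult_left_le)
    ultimately have "weight a b p q \<le> 6 * \<mu>"
      using norm_triangle_ineq[of a b] unfolding weight_def by linarith
    then show ?thesis using \<mu>0 by simp
  qed
qed

section \<open>Separated pairs of waves are linearly independent\<close>

text \<open>If the variation of \<open>wave p q\<close> is at least one, the weight dominates both coefficients and the two
terms can be estimated separately. If it is smaller, the factor \<open>a + b wave p q\<close> has supremum
and total variation bounded by the weight, and integration by parts transfers the bound for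
integrals of \<open>wave r w\<close>.\<close>

lemma distant_wave_integral_le:
  fixes a b :: complex
  assumes far: "0 < W" "W \<le> osc r w" "W \<le> osc (r + p) (w + q)" and st: "0 \<le> s" "s \<le> t" "t \<le> l"
  shows "norm (integral {s..t} (\<lambda>u. wave r w u * (a + b * wave p q u))) \<le> 400 * weight a b p q * l / sqrt W"
proof -
  define \<delta> where "\<delta> = 12 * l / sqrt W"
  have \<delta>: "norm (integral {s..v} (wave r' w')) \<le> \<delta>" if "W \<le> osc r' w'" "s \<le> v" "v \<le> t" for r' w' v
  proof -
    have "norm (integral {s..v} (wave r' w')) \<le> 12 * l / sqrt (osc r' w')"
      using that far st by (intro wave_integral_le) auto
    also have "\<dots> \<le> \<delta>" unfolding \<delta>_def using that far l_pos by (intro divide_left_mono) auto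
    finally show ?thesis .
  qed
  have \<delta>0: "0 \<le> \<delta>" using far l_pos by (simp add: \<delta>_def)
  have "norm (integral {s..t} (\<lambda>u. wave r w u * (a + b * wave p q u))) \<le> 33 * (weight a b p q * \<delta>)"
  proof (cases "1 \<le> osc p q")
    case True
    have "integral {s..t} (\<lambda>u. wave r w u * (a + b * wave p q u))
        = integral {s..t} (\<lambda>u. a * wave r w u + b * wave (r + p) (w + q) u)"
      by (simp add: wave_add algebra_simps)
    also have "\<dots> = a * integral {s..t} (wave r w) + b * integral {s..t} (wave (r + p) (w + q))"
      using st by (subst integral_add) (auto intro!: integrable_on_mult_right wave_integrable)
    finally have "norm (integral {s..t} (\<lambda>u. wave r w u * (a + b * wave p q u)))
        \<le> norm a * \<delta> + norm b * \<delta>"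
      using \<delta>[OF far(2) st(2)] \<delta>[OF far(3) st(2)]
      by (auto simp: norm_mult intro!: order_trans[OF norm_triangle_ineq] add_mono mult_left_mono)
    moreover have "norm a + norm b \<le> 2 * weight a b p q"
    proof -
      have "norm a \<le> norm (a + b) + norm b" using norm_triangle_ineq4[of "a + b" b] by simp
      then show ?thesis unfolding weight_def min_absorb1[OF True] mult_1_right distrib_left using norm_ge_zero[of "a + b"] by linarith
    qed
    then have "norm a + norm b \<le> 33 * weight a b p q"
      using weight_nonneg[of a b p q] by linarith
    then have "(norm a + norm b) * \<delta> \<le> (33 * weight a b p q) * \<delta>"
      using \<delta>0 by (rule mult_right_mono)
    ultimately show ?thesis by (simp only: distrib_right mult.assoc)
  next
    case False
    define G where "G v = integral {s..v} (wave r w)" for v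
    define h where "h u = a + b * wave p q u" for u
    define h' where "h' u = b * (of_real (2 * pi * (p * x' u + q * y' u)) * (\<i> * wave p q u))" for u
    have sub: "u \<in> {0..l}" if "u \<in> {s..t}" for u using that st by auto
    have wt: "norm (a + b) + norm b * osc p q = weight a b p q" using False by (simp add: weight_def)
    have dG: "(G has_vector_derivative wave r w u) (at u within {s..t})" if "u \<in> {s..t}" for u
      unfolding G_def[abs_def] using that st
      by (intro integral_has_vector_derivative continuous_on_subset[OF continuous_on_wave]) auto
    have dh: "(h has_vector_derivative h' u) (at u within {s..t})" if u: "u \<in> {s..t}" for u
    proof -
      have "(phase p q has_derivative (\<lambda>v. (p * x' u + q * y' u) * v)) (at u within {s..t})"
        using DERIV_subset[OF phase_deriv(1)[OF sub[OF u]], of "{s..t}"] sub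
        by (auto simp: has_field_derivative_def)
      then have "(wave p q has_derivative (\<lambda>v. v *\<^sub>R (of_real (2 * pi * (p * x' u + q * y' u)) * (\<i> * wave p q u)))) (at u within {s..t})"
        unfolding wave_def[abs_def]
        by (auto intro!: derivative_eq_intros simp: scaleR_conv_of_real algebra_simps)
      then have "(wave p q has_vector_derivative of_real (2 * pi * (p * x' u + q * y' u)) * (\<i> * wave p q u)) (at u within {s..t})"
        by (simp add: has_vector_derivative_def)
      then have "((\<lambda>u. a + b * wave p q u) has_vector_derivative 0 + h' u) (at u within {s..t})"
        unfolding h'_def by (intro has_vector_derivative_add has_vector_derivative_const has_vector_derivative_mult_right)
      then show ?thesis by (simp add: h_def[abs_def])
    qed
    have "((\<lambda>u. G u * h' u + wave r w u * h u) has_integral G t * h t - G s * h s) {s..t}"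
      using st by (intro fundamental_theorem_of_calculus has_vector_derivative_mult dG dh) auto
    moreover have cG: "continuous_on {s..t} G" and ch: "continuous_on {s..t} h"
      unfolding continuous_on_eq_continuous_within
      using dG dh has_vector_derivative_continuous by blast+
    moreover have ch': "continuous_on {s..t} h'"
      unfolding h'_def[abs_def] using st
      by (intro continuous_intros continuous_on_subset[OF continuous_on_wave]
          continuous_on_subset[OF DERIV_continuous_on[OF x'_deriv]]
          continuous_on_subset[OF DERIV_continuous_on[OF y'_deriv]]) auto
    moreover have cw: "continuous_on {s..t} (wave r w)"
      using st by (intro continuous_on_subset[OF continuous_on_wave]) auto
    ultimately have "integral {s..t} (\<lambda>u. G u * h' u) + integral {s..t} (\<lambda>u. wave r w u * h u) = G t * h t - G s * h s"
      by (subst integral_add[symmetric]) (auto intro!: integrable_continuous_interval continuous_intros integral_unique)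
    moreover have "G s = 0" by (simp add: G_def)
    ultimately have parts: "integral {s..t} (\<lambda>u. wave r w u * h u) = G t * h t - integral {s..t} (\<lambda>u. G u * h' u)"
      by (simp add: algebra_simps)
    have "norm (h t) \<le> norm (a + b) + norm b * (13 * osc p q)"
    proof -
      have "h t = (a + b) + b * (wave p q t - 1)" by (simp add: h_def algebra_simps)
      then have "norm (h t) \<le> norm (a + b) + norm (b * (wave p q t - 1))"
        by (metis norm_triangle_ineq)
      also have "\<dots> \<le> norm (a + b) + norm b * (13 * osc p q)"
        unfolding norm_mult using sub[of t] st by (intro add_left_mono mult_left_mono norm_wave_minus_one_le) auto
      finally show ?thesis .
    qed
    also have "\<dots> \<le> 13 * (norm (a + b) + norm b * osc p q)" by (simp add: algebra_simps)
    finally have hb: "norm (h t) \<le> 13 * weight a b p q" by (simp add: wt)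
    have h'b: "norm (h' u) \<le> norm b * (13 * osc p q / l)" if u: "u \<in> {s..t}" for u
    proof -
      have "\<bar>p * x' u + q * y' u\<bar> \<le> 2 * osc p q / l"
        using phase_deriv_le[OF sub[OF u], of p q] l_pos by (simp add: field_simps)
      then have "2 * pi * \<bar>p * x' u + q * y' u\<bar> \<le> 6.5 * (2 * osc p q / l)"
        using pi_approx by (intro mult_mono) auto
      then have "norm b * (2 * pi * \<bar>p * x' u + q * y' u\<bar>) \<le> norm b * (6.5 * (2 * osc p q / l))"
        by (intro mult_left_mono) auto
      then show ?thesis by (simp add: h'_def norm_mult abs_mult del: of_real_add of_real_mult)
    qed
    have "norm (integral {s..t} (\<lambda>u. G u * h' u)) \<le> (\<delta> * (norm b * (13 * osc p q / l))) * (t - s)"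
    proof (rule integral_bound)
      show "norm (G u * h' u) \<le> \<delta> * (norm b * (13 * osc p q / l))" if "u \<in> {s..t}" for u
        unfolding norm_mult using that \<delta>0 \<delta>[OF far(2), of u] h'b[OF that]
        by (intro mult_mono) (auto simp: G_def)
    qed (use st in \<open>auto intro!: continuous_intros cG ch'\<close>)
    also have "\<dots> \<le> (\<delta> * (norm b * (13 * osc p q / l))) * l"
      using st \<delta>0 osc_nonneg[of p q] l_pos by (intro mult_left_mono) auto
    also have "\<dots> = 13 * (norm b * osc p q) * \<delta>" using l_pos by simp
    also have "13 * (norm b * osc p q) * \<delta> \<le> 13 * weight a b p q * \<delta>"
    proof -
      have "norm b * osc p q \<le> weight a b p q" using wt norm_ge_zero[of "a + b"] by linarith
      then show ?thesis using \<delta>0 by (intro mult_right_mono mult_left_mono) simp_all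
    qed
    finally have second: "norm (integral {s..t} (\<lambda>u. G u * h' u)) \<le> 13 * weight a b p q * \<delta>" .
    have first: "norm (G t * h t) \<le> \<delta> * (13 * weight a b p q)"
      unfolding norm_mult using \<delta>0 \<delta>[OF far(2) st(2)] hb by (intro mult_mono) (auto simp: G_def)
    have "norm (integral {s..t} (\<lambda>u. wave r w u * h u)) \<le> 26 * (weight a b p q * \<delta>)"
      unfolding parts using order_trans[OF norm_triangle_ineq4 add_mono[OF first second]]
      by (simp add: algebra_simps)
    also have "\<dots> \<le> 33 * (weight a b p q * \<delta>)"
      using \<delta>0 weight_nonneg[of a b p q] by (intro mult_right_mono) auto
    finally show ?thesis by (simp add: h_def)
  qed
  also have "\<dots> = 396 * (weight a b p q * l / sqrt W)" by (simp add: \<delta>_def)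
  also have "\<dots> \<le> 400 * (weight a b p q * l / sqrt W)"
    using weight_nonneg[of a b p q] l_pos far by (intro mult_right_mono) auto
  finally show ?thesis by simp
qed


text \<open>The involution \<open>\<sigma>\<close> groups the frequencies into clusters of one or two elements; a singleton
counts as a pair with itself, with constant phase difference. Integrating the vanishing sum
against a frequency of the cluster of maximal weight, over any subinterval, bounds that
cluster by the contributions of the others, each of which is small by separation and has no larger
weight. The hypothesis on \<open>W\<close> is what makes this bound smaller than the weight detected
in the cluster.\<close>

lemma no_vanishing_wave_sum:
  fixes S :: "'a set" and P Q :: "'a \<Rightarrow> real" and a :: "'a \<Rightarrow> complex" and \<sigma> :: "'a \<Rightarrow> 'a"
  assumes fin: "finite S"
    and \<sigma>: "\<And>\<xi>. \<xi> \<in> S \<Longrightarrow> \<sigma> \<xi> \<in> S" "\<And>\<xi>. \<xi> \<in> S \<Longrightarrow> \<sigma> (\<sigma> \<xi>) = \<xi>"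
    and partner: "\<And>\<xi>. \<xi> \<in> S \<Longrightarrow> \<sigma> \<xi> \<noteq> \<xi> \<Longrightarrow> 0 < osc (P (\<sigma> \<xi>) - P \<xi>) (Q (\<sigma> \<xi>) - Q \<xi>)"
    and far: "\<And>\<xi> \<eta>. \<xi> \<in> S \<Longrightarrow> \<eta> \<in> S \<Longrightarrow> \<eta> \<noteq> \<xi> \<Longrightarrow> \<eta> \<noteq> \<sigma> \<xi> \<Longrightarrow> W \<le> osc (P \<eta> - P \<xi>) (Q \<eta> - Q \<xi>)"
    and W: "10 ^ 28 * real (card S) < sqrt W"
    and vanish: "\<And>t. t \<in> {0..l} \<Longrightarrow> (\<Sum>\<xi>\<in>S. a \<xi> * wave (P \<xi>) (Q \<xi>) t) = 0"
    and \<xi>: "\<xi> \<in> S"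
  shows "a \<xi> = 0"
proof -
  define w where "w \<xi> = wave (P \<xi>) (Q \<xi>)" for \<xi>
  define f where "f \<xi> t = a \<xi> * w \<xi> t + a (\<sigma> \<xi>) * w (\<sigma> \<xi>) t" for \<xi> t
  define M where "M \<xi> = weight (a \<xi>) (a (\<sigma> \<xi>)) (P (\<sigma> \<xi>) - P \<xi>) (Q (\<sigma> \<xi>) - Q \<xi>)" for \<xi>
  have sW: "0 < sqrt W" by (rule le_less_trans[OF _ W]) simp
  then have W0: "0 < W" by simp
  have N1: "1 \<le> real (card S)" using fin \<xi> by (simp add: Suc_le_eq card_gt_0_iff) blast
  \<comment> \<open>every frequency occurs in \<open>f\<close> at itself and at its partner, so the sum is twice the given one\<close>
  have f_sum: "(\<Sum>\<eta>\<in>S. f \<eta> t) = 0" if "t \<in> {0..l}" for t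
  proof -
    have "(\<Sum>\<eta>\<in>S. a (\<sigma> \<eta>) * w (\<sigma> \<eta>) t) = (\<Sum>\<eta>\<in>S. a \<eta> * w \<eta> t)"
      by (rule sum.reindex_bij_witness[of _ \<sigma> \<sigma>]) (auto simp: \<sigma>)
    then show ?thesis using vanish[OF that] by (simp add: f_def w_def sum.distrib)
  qed
  have w_quot: "wave (- P \<zeta>) (- Q \<zeta>) t * w \<eta> t = wave (P \<eta> - P \<zeta>) (Q \<eta> - Q \<zeta>) t" for \<eta> \<zeta> t
    using wave_add[of "- P \<zeta>" "P \<eta>" "- Q \<zeta>" "Q \<eta>" t] by (simp add: w_def)
  have w_shift: "w (\<sigma> \<eta>) t = w \<eta> t * wave (P (\<sigma> \<eta>) - P \<eta>) (Q (\<sigma> \<eta>) - Q \<eta>) t" for \<eta> t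
    using wave_add[of "P \<eta>" "P (\<sigma> \<eta>) - P \<eta>" "Q \<eta>" "Q (\<sigma> \<eta>) - Q \<eta>" t] by (simp add: w_def)
  have max_zero: "M \<xi> = 0" if \<xi>: "\<xi> \<in> S" and max: "\<And>\<eta>. \<eta> \<in> S \<Longrightarrow> M \<eta> \<le> M \<xi>" for \<xi>
  proof -
    have M0: "0 \<le> M \<xi>" by (simp add: M_def weight_nonneg)
    define \<mu> where "\<mu> = real (card S) * (400 * M \<xi> / sqrt W)"
    have test: "norm (integral {s..t} (\<lambda>u. wave (- P \<zeta>) (- Q \<zeta>) u * f \<xi> u)) \<le> \<mu> * l"
      if \<zeta>: "\<zeta> = \<xi> \<or> \<zeta> = \<sigma> \<xi>" and st: "0 \<le> s" "s \<le> t" "t \<le> l" for \<zeta> s t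
    proof -
      let ?\<chi> = "wave (- P \<zeta>) (- Q \<zeta>)"
      define I where "I \<eta> = integral {s..t} (\<lambda>u. ?\<chi> u * f \<eta> u)" for \<eta>
      have \<zeta>S: "\<zeta> \<in> S" using \<zeta> \<xi> \<sigma> by auto
      \<comment> \<open>\<open>\<xi>\<close> and \<open>\<sigma> \<xi>\<close> may coincide; counting with the cardinality of the cluster covers both cases\<close>
      have pair: "{\<xi>, \<sigma> \<xi>} = {\<zeta>, \<sigma> \<zeta>}" using \<zeta> \<sigma>(2)[OF \<xi>] by auto
      have int: "(\<lambda>u. ?\<chi> u * f \<eta> u) integrable_on {s..t}" for \<eta>
        unfolding f_def w_def using st
        by (intro integrable_continuous_interval continuous_intros continuous_on_subset[OF continuous_on_wave]) auto
      have "(\<Sum>\<eta>\<in>S. I \<eta>) = integral {s..t} (\<lambda>u. \<Sum>\<eta>\<in>S. ?\<chi> u * f \<eta> u)"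
        unfolding I_def by (rule integral_sum[symmetric]) (use fin int in auto)
      also have "\<dots> = integral {s..t} (\<lambda>u. 0)"
        using f_sum st by (intro integral_cong) (simp add: sum_distrib_left[symmetric])
      finally have total: "(\<Sum>\<eta>\<in>S. I \<eta>) = 0" by simp
      have split: "(\<Sum>\<eta>\<in>S. I \<eta>) = (\<Sum>\<eta>\<in>S - {\<xi>, \<sigma> \<xi>}. I \<eta>) + (\<Sum>\<eta>\<in>{\<xi>, \<sigma> \<xi>}. I \<eta>)"
        using fin \<xi> \<sigma> by (intro sum.subset_diff) auto
      have "f (\<sigma> \<xi>) = f \<xi>" using \<sigma>(2)[OF \<xi>] by (auto simp: f_def)
      then have same: "I (\<sigma> \<xi>) = I \<xi>" by (simp add: I_def)
      have cluster: "(\<Sum>\<eta>\<in>{\<xi>, \<sigma> \<xi>}. I \<eta>) = of_nat (card {\<xi>, \<sigma> \<xi>}) * I \<xi>"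
        by (cases "\<sigma> \<xi> = \<xi>") (simp_all add: same)
      have "- (\<Sum>\<eta>\<in>S - {\<xi>, \<sigma> \<xi>}. I \<eta>) = of_nat (card {\<xi>, \<sigma> \<xi>}) * I \<xi>"
        by (rule minus_unique) (simp only: split[symmetric] cluster[symmetric] total)
      from arg_cong[OF this, of norm]
      have eq: "real (card {\<xi>, \<sigma> \<xi>}) * norm (I \<xi>) = norm (\<Sum>\<eta>\<in>S - {\<xi>, \<sigma> \<xi>}. I \<eta>)"
        by (simp only: norm_minus_cancel norm_mult norm_of_nat)
      have "1 * norm (I \<xi>) \<le> real (card {\<xi>, \<sigma> \<xi>}) * norm (I \<xi>)"
        by (intro mult_right_mono) (auto simp: card_insert_if)
      then have "norm (I \<xi>) \<le> norm (\<Sum>\<eta>\<in>S - {\<xi>, \<sigma> \<xi>}. I \<eta>)" using eq by simp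
      also have "\<dots> \<le> (\<Sum>\<eta>\<in>S - {\<xi>, \<sigma> \<xi>}. 400 * M \<xi> * l / sqrt W)"
      proof (rule sum_norm_le)
        fix \<eta> assume "\<eta> \<in> S - {\<xi>, \<sigma> \<xi>}"
        then have \<eta>: "\<eta> \<in> S" "\<eta> \<noteq> \<zeta>" "\<eta> \<noteq> \<sigma> \<zeta>" unfolding pair by auto
        then have \<sigma>\<eta>: "\<sigma> \<eta> \<in> S" "\<sigma> \<eta> \<noteq> \<zeta>" "\<sigma> \<eta> \<noteq> \<sigma> \<zeta>" using \<sigma>(1)[OF \<eta>(1)] \<sigma>(2)[OF \<eta>(1)] \<sigma>(2)[OF \<zeta>S] \<eta>(2,3) by auto
        have "?\<chi> u * f \<eta> u = wave (P \<eta> - P \<zeta>) (Q \<eta> - Q \<zeta>) u *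
            (a \<eta> + a (\<sigma> \<eta>) * wave (P (\<sigma> \<eta>) - P \<eta>) (Q (\<sigma> \<eta>) - Q \<eta>) u)" for u
          unfolding f_def w_shift[of \<eta>] w_quot[of \<zeta> u \<eta>, symmetric] by (simp add: algebra_simps)
        then have "norm (I \<eta>) \<le> 400 * M \<eta> * l / sqrt W"
          unfolding M_def I_def using distant_wave_integral_le[OF W0 _ _ st, of "P \<eta> - P \<zeta>" "Q \<eta> - Q \<zeta>"
            "P (\<sigma> \<eta>) - P \<eta>" "Q (\<sigma> \<eta>) - Q \<eta>" "a \<eta>" "a (\<sigma> \<eta>)"]
            far[OF \<zeta>S \<eta>] far[OF \<zeta>S \<sigma>\<eta>] by simp
        also have "\<dots> \<le> 400 * M \<xi> * l / sqrt W"
          using max[OF \<eta>(1)] sW l_pos by (intro divide_right_mono mult_right_mono mult_left_mono) auto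
        finally show "norm (I \<eta>) \<le> 400 * M \<xi> * l / sqrt W" .
      qed
      also have "\<dots> = real (card (S - {\<xi>, \<sigma> \<xi>})) * (400 * M \<xi> * l / sqrt W)" by simp
      also have "\<dots> \<le> real (card S) * (400 * M \<xi> * l / sqrt W)"
        using M0 sW l_pos fin by (intro mult_right_mono) (auto intro: card_mono)
      also have "\<dots> = \<mu> * l" by (simp add: \<mu>_def)
      finally show ?thesis by (simp add: I_def)
    qed
    have inv: "wave (- P \<zeta>) (- Q \<zeta>) u * w \<zeta> u = 1" for \<zeta> u
      unfolding w_quot by (simp add: wave_def phase_def)
    have "M \<xi> \<le> 10 ^ 25 * \<mu>"
      unfolding M_def
    proof (rule two_waves_detected)
      fix s t assume st: "0 \<le> s" "s \<le> t" "t \<le> l"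
      have "wave (- P \<xi>) (- Q \<xi>) u * f \<xi> u = a \<xi> + a (\<sigma> \<xi>) * wave (P (\<sigma> \<xi>) - P \<xi>) (Q (\<sigma> \<xi>) - Q \<xi>) u" for u
        unfolding f_def w_quot[symmetric] distrib_left using inv[of \<xi> u] by (simp add: mult.left_commute)
      then show "norm (integral {s..t} (\<lambda>u. a \<xi> + a (\<sigma> \<xi>) * wave (P (\<sigma> \<xi>) - P \<xi>) (Q (\<sigma> \<xi>) - Q \<xi>) u)) \<le> \<mu> * l"
        using test[OF _ st, of \<xi>] by simp
    next
      have "wave (- P (\<sigma> \<xi>)) (- Q (\<sigma> \<xi>)) u * f \<xi> u = a \<xi> * wave (- (P (\<sigma> \<xi>) - P \<xi>)) (- (Q (\<sigma> \<xi>) - Q \<xi>)) u + a (\<sigma> \<xi>)" for u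
        unfolding f_def minus_diff_eq w_quot[symmetric] distrib_left using inv[of "\<sigma> \<xi>" u] by (simp add: mult.left_commute)
      then show "norm (integral {0..l} (\<lambda>u. a \<xi> * wave (- (P (\<sigma> \<xi>) - P \<xi>)) (- (Q (\<sigma> \<xi>) - Q \<xi>)) u + a (\<sigma> \<xi>))) \<le> \<mu> * l"
        using test[of "\<sigma> \<xi>" 0 l] l_pos by simp
    qed
    also have "\<dots> = (4 * 10 ^ 27 * real (card S) / sqrt W) * M \<xi>" by (simp add: \<mu>_def)
    finally have "(1 - 4 * 10 ^ 27 * real (card S) / sqrt W) * M \<xi> \<le> 0" by (simp add: algebra_simps)
    \<comment> \<open>\<open>400\<close> from the upper bound times \<open>10\<^sup>2\<^sup>5\<close> from the detection of the weight\<close>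
    moreover have "4 * 10 ^ 27 * real (card S) < sqrt W" using W N1 by simp
    then have "4 * 10 ^ 27 * real (card S) / sqrt W < 1" using sW by simp
    ultimately show "M \<xi> = 0" using M0 by (simp add: mult_le_0_iff)
  qed
  have "finite (M ` S)" "M ` S \<noteq> {}" using fin \<xi> by auto
  then obtain \<eta> where \<eta>: "\<eta> \<in> S" "M \<eta> = Max (M ` S)" by (metis (no_types, lifting) Max_in imageE)
  have "M \<eta> = 0" by (rule max_zero[OF \<eta>(1)]) (simp add: \<eta>(2) fin)
  moreover have "M \<xi> \<le> M \<eta>" unfolding \<eta>(2) using fin \<xi> by simp
  ultimately have "M \<xi> = 0" by (simp add: M_def weight_nonneg antisym)
  then have z: "norm (a \<xi> + a (\<sigma> \<xi>)) + norm (a (\<sigma> \<xi>)) * min 1 (osc (P (\<sigma> \<xi>) - P \<xi>) (Q (\<sigma> \<xi>) - Q \<xi>)) = 0"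
    by (simp add: M_def weight_def)
  then have z': "a \<xi> + a (\<sigma> \<xi>) = 0" "norm (a (\<sigma> \<xi>)) * min 1 (osc (P (\<sigma> \<xi>) - P \<xi>) (Q (\<sigma> \<xi>) - Q \<xi>)) = 0"
    by (subst (asm) add_nonneg_eq_0_iff; simp add: osc_nonneg)+
  show "a \<xi> = 0"
  proof (cases "\<sigma> \<xi> = \<xi>")
    case True then show ?thesis using z'(1) by simp
  next
    case False
    then show ?thesis using z' partner[OF \<xi>] by (auto simp: min_def split: if_splits)
  qed
qed

end

section \<open>The number of representations as a sum of two squares\<close>

definition two_squares :: "nat \<Rightarrow> (int \<times> int) set" where
  "two_squares n = {(x, y). x\<^sup>2 + y\<^sup>2 = int n}"

lemma finite_two_squares: "finite (two_squares n)"
proof (rule finite_subset)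
  show "two_squares n \<subseteq> {- int n..int n} \<times> {- int n..int n}"
  proof clarify
    fix x y assume "(x, y) \<in> two_squares n"
    then have xy: "x\<^sup>2 + y\<^sup>2 = int n" by (simp add: two_squares_def)
    have *: "\<bar>z\<bar> \<le> z\<^sup>2" for z :: int
      using self_le_power[of "\<bar>z\<bar>" 2] by (cases "z = 0") auto
    show "x \<in> {- int n..int n} \<and> y \<in> {- int n..int n}"
      using *[of x] *[of y] xy zero_le_power2[of x] zero_le_power2[of y]
      by (auto simp: abs_le_iff)
  qed
qed auto

text \<open>Multiplication by the Gaussian integer \<open>a + b \<i>\<close>, with pairs for Gaussian integers.\<close>

definition gauss_mult :: "int \<Rightarrow> int \<Rightarrow> int \<times> int \<Rightarrow> int \<times> int" where
  "gauss_mult a b = (\<lambda>(u, v). (a * u - b * v, a * v + b * u))"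

lemma gauss_mult_commute: "gauss_mult a b (gauss_mult c d z) = gauss_mult c d (gauss_mult a b z)"
  by (cases z) (simp add: gauss_mult_def algebra_simps)

lemma gauss_mult_funpow_commute:
  "gauss_mult a b ((gauss_mult c d ^^ n) z) = (gauss_mult c d ^^ n) (gauss_mult a b z)"
  by (induction n) (auto simp: gauss_mult_commute[of a b c d])

text \<open>A Gaussian prime \<open>a + b \<i>\<close> above \<open>p\<close>, or its conjugate, divides every Gaussian integer whose norm
is a multiple of \<open>p\<close>: modulo \<open>p\<close> the product \<open>(a x + b y) (a x - b y)\<close> is
\<open>a\<^sup>2 (x\<^sup>2 + y\<^sup>2)\<close>, so that \<open>p\<close> divides one of its factors.\<close>

lemma gauss_prime_divides:
  fixes a b x y p :: int
  assumes p: "prime p" "a\<^sup>2 + b\<^sup>2 = p" and dvd: "p dvd x\<^sup>2 + y\<^sup>2"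
  shows "\<exists>u v. ((x, y) = gauss_mult a b (u, v) \<or> (x, y) = gauss_mult a (- b) (u, v)) \<and>
               p * (u\<^sup>2 + v\<^sup>2) = x\<^sup>2 + y\<^sup>2"
proof -
  have key: "\<exists>u v. (x, y) = gauss_mult a c (u, v) \<and> p * (u\<^sup>2 + v\<^sup>2) = x\<^sup>2 + y\<^sup>2"
    if c: "a\<^sup>2 + c\<^sup>2 = p" and d: "p dvd a * x + c * y" for c
  proof -
    have "(a * y - c * x)\<^sup>2 = p * (x\<^sup>2 + y\<^sup>2) - (a * x + c * y) * (a * x + c * y)"
      by (simp add: c[symmetric] power2_eq_square algebra_simps)
    also have "p dvd \<dots>" using d by (intro dvd_diff dvd_triv_left dvd_mult)
    finally have "p dvd a * y - c * x" using p(1) prime_dvd_power by blast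
    then obtain v where v: "a * y - c * x = p * v" by (auto elim: dvdE)
    from d obtain u where u: "a * x + c * y = p * u" by (auto elim: dvdE)
    have p0: "p \<noteq> 0" using p(1) by auto
    have "p * (a * u - c * v) = a * (a * x + c * y) - c * (a * y - c * x)"
      by (simp only: u v) (simp add: algebra_simps)
    also have "\<dots> = p * x" by (simp add: c[symmetric] power2_eq_square algebra_simps)
    finally have X: "a * u - c * v = x" using p0 by simp
    have "p * (a * v + c * u) = a * (a * y - c * x) + c * (a * x + c * y)"
      by (simp only: u v) (simp add: algebra_simps)
    also have "\<dots> = p * y" by (simp add: c[symmetric] power2_eq_square algebra_simps)
    finally have Y: "a * v + c * u = y" using p0 by simp
    have "p * (u\<^sup>2 + v\<^sup>2) = x\<^sup>2 + y\<^sup>2"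
      by (simp add: c[symmetric] X[symmetric] Y[symmetric] power2_eq_square algebra_simps)
    then show ?thesis using X Y by (auto simp: gauss_mult_def)
  qed
  have "(a * x + b * y) * (a * x + - b * y) = a\<^sup>2 * (x\<^sup>2 + y\<^sup>2) - p * y\<^sup>2"
    by (simp add: p(2)[symmetric] power2_eq_square algebra_simps)
  also have "p dvd \<dots>" using dvd by (intro dvd_diff dvd_triv_left dvd_mult)
  finally consider "p dvd a * x + b * y" | "p dvd a * x + - b * y"
    using p(1) prime_dvd_mult_iff by blast
  then show ?thesis
  proof cases
    case 1 then show ?thesis using key[of b] p(2) by blast
  next
    case 2 then show ?thesis using key[of "- b"] p(2) by (simp only: power2_minus) blast
  qed
qed

text \<open>Splitting off one factor of norm \<open>p\<close> at a time leaves \<open>k + 1\<close> possibilities for the numbers of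
factors \<open>a + b \<i>\<close> and \<open>a - b \<i>\<close>, because the order does not matter. Choosing the factors one by one
without collecting them would only give \<open>2\<^sup>k\<close>.\<close>

lemma two_squares_split_prime:
  fixes a b :: int
  assumes p: "prime p" "a\<^sup>2 + b\<^sup>2 = int p"
  shows "two_squares (p ^ k * m) \<subseteq>
    (\<Union>j\<le>k. (\<lambda>z. (gauss_mult a b ^^ j) ((gauss_mult a (- b) ^^ (k - j)) z)) ` two_squares m)"
proof (induction k)
  case (Suc k)
  show ?case
  proof
    fix z assume z: "z \<in> two_squares (p ^ Suc k * m)"
    obtain x y where xy: "z = (x, y)" by (cases z)
    have n: "x\<^sup>2 + y\<^sup>2 = int p * int (p ^ k * m)" using z by (simp add: xy two_squares_def)
    then have "int p dvd x\<^sup>2 + y\<^sup>2" by simp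
    then obtain u v where uv: "z = gauss_mult a b (u, v) \<or> z = gauss_mult a (- b) (u, v)"
      "int p * (u\<^sup>2 + v\<^sup>2) = x\<^sup>2 + y\<^sup>2"
      using gauss_prime_divides[of "int p" a b x y] p xy by auto
    then have "(u, v) \<in> two_squares (p ^ k * m)"
      using n p(1) by (auto simp: two_squares_def prime_gt_0_nat dest!: prime_gt_0_nat)
    then obtain j w where jw: "j \<le> k" "w \<in> two_squares m"
      "(u, v) = (gauss_mult a b ^^ j) ((gauss_mult a (- b) ^^ (k - j)) w)"
      using Suc.IH by blast
    from uv(1) show "z \<in> (\<Union>j\<le>Suc k. (\<lambda>z. (gauss_mult a b ^^ j) ((gauss_mult a (- b) ^^ (Suc k - j)) z)) ` two_squares m)"
    proof
      assume "z = gauss_mult a b (u, v)"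
      then have "z = (gauss_mult a b ^^ Suc j) ((gauss_mult a (- b) ^^ (Suc k - Suc j)) w)"
        by (simp add: jw(3))
      then show ?thesis using jw(1,2) by (intro UN_I[of "Suc j"]) auto
    next
      assume "z = gauss_mult a (- b) (u, v)"
      then have "z = (gauss_mult a b ^^ j) ((gauss_mult a (- b) ^^ (Suc k - j)) w)"
        using jw(1) by (simp add: jw(3) gauss_mult_funpow_commute Suc_diff_le)
      then show ?thesis using jw(1,2) by (intro UN_I[of j]) auto
    qed
  qed
qed auto

text \<open>Thue's argument: there are more than \<open>p\<close> pairs \<open>(u, v)\<close> with entries up to \<open>\<surd>p\<close>, so two of
them give the same residue of \<open>u y - v x\<close>. Their difference \<open>(U, V)\<close> is a nonzero pair with
\<open>U y \<equiv> V x\<close>, hence \<open>p\<close> divides \<open>U\<^sup>2 + V\<^sup>2\<close>, which is less than \<open>2 p\<close>.\<close>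

lemma prime_sum_two_squaresI:
  fixes x y :: int
  assumes p: "prime (p::nat)" and dvd: "int p dvd x\<^sup>2 + y\<^sup>2" and nd: "\<not> int p dvd y"
  shows "\<exists>a b::int. a\<^sup>2 + b\<^sup>2 = int p"
proof -
  define s where "s = nat \<lfloor>sqrt (real p)\<rfloor>"
  have s1: "real s \<le> sqrt (real p)" and s2: "sqrt (real p) < real s + 1"
    by (auto simp: s_def)
  have "real (s\<^sup>2) \<le> real p"
    using s1 by (metis of_nat_0_le_iff of_nat_power real_sqrt_ge_0_iff real_sqrt_le_iff real_sqrt_unique)
  moreover have "s\<^sup>2 \<noteq> p" using p
    by (metis prime_power_iff zero_neq_numeral numeral_eq_one_iff semiring_norm(85))
  ultimately have sp: "s\<^sup>2 < p" by (simp add: le_neq_implies_less)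
  have "real p < (real s + 1)\<^sup>2"
    using s2 by (metis of_nat_0_le_iff real_sqrt_ge_0_iff real_sqrt_pow2 power_strict_mono pos2)
  then have "real p < real ((s + 1)\<^sup>2)" by (simp add: add.commute)
  then have ps: "p < (s + 1)\<^sup>2" using of_nat_less_iff by blast
  have p0: "int p > 0" using p by (simp add: prime_gt_0_nat)
  define f where "f = (\<lambda>(u, v). (u * y - v * x) mod int p)"
  let ?D = "{0..int s} \<times> {0..int s}"
  have "f ` ?D \<subseteq> {0..<int p}" using p0 by (auto simp: f_def)
  then have "card (f ` ?D) \<le> p" using card_mono[of "{0..<int p}"] by fastforce
  moreover have "card ?D = (s + 1)\<^sup>2" by (simp add: power2_eq_square nat_add_distrib)
  ultimately have "\<not> inj_on f ?D" using ps pigeonhole[of f ?D] by linarith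
  then obtain u v u' v' where w: "(u, v) \<in> ?D" "(u', v') \<in> ?D" "(u, v) \<noteq> (u', v')" "f (u, v) = f (u', v')"
    unfolding inj_on_def by blast
  define U where "U = u - u'"
  define V where "V = v - v'"
  have "int p dvd (u * y - v * x) - (u' * y - v' * x)"
    using w(4) by (simp add: f_def mod_eq_dvd_iff)
  then have d: "int p dvd U * y - V * x" by (simp add: U_def V_def algebra_simps)
  have "(U\<^sup>2 + V\<^sup>2) * y\<^sup>2 = (U * y - V * x) * (U * y + V * x) + V\<^sup>2 * (x\<^sup>2 + y\<^sup>2)"
    by (simp add: power2_eq_square algebra_simps)
  also have "int p dvd \<dots>" using d dvd by (intro dvd_add dvd_mult2[OF d] dvd_mult[OF dvd])
  finally have "int p dvd U\<^sup>2 + V\<^sup>2"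
    using p nd by (metis prime_dvd_mult_iff prime_dvd_power prime_int_nat_transfer prime_nat_int_transfer)
  then obtain c where c: "U\<^sup>2 + V\<^sup>2 = int p * c" by (auto elim: dvdE)
  have "\<bar>U\<bar> \<le> int s" "\<bar>V\<bar> \<le> int s" using w by (auto simp: U_def V_def)
  then have "U\<^sup>2 \<le> (int s)\<^sup>2" "V\<^sup>2 \<le> (int s)\<^sup>2" by (metis abs_ge_zero power2_abs power_mono)+
  moreover have "(int s)\<^sup>2 < int p" using sp by (metis of_nat_less_iff of_nat_power)
  ultimately have "int p * c < int p * 2" using c by linarith
  then have "c < 2" using p0 by simp
  moreover have "U\<^sup>2 + V\<^sup>2 > 0" using w(3) by (simp add: U_def V_def sum_power2_gt_zero_iff)
  then have "c > 0" using c p0 by (simp add: zero_less_mult_iff)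
  ultimately have "c = 1" by simp
  then show ?thesis using c by auto
qed

text \<open>If \<open>p\<close> is a sum of two squares, this counts the possibilities of the splitting above. Otherwise
\<open>p\<close> can only divide \<open>x\<^sup>2 + y\<^sup>2\<close> by dividing both \<open>x\<close> and \<open>y\<close>, so the representations are
multiples of those with two factors \<open>p\<close> fewer.\<close>

lemma card_two_squares_prime_power:
  assumes p: "prime (p::nat)" and m: "\<not> p dvd m"
  shows "card (two_squares (p ^ k * m)) \<le> (k + 1) * card (two_squares m)"
proof (cases "\<exists>a b::int. a\<^sup>2 + b\<^sup>2 = int p")
  case True
  then obtain a b where ab: "a\<^sup>2 + b\<^sup>2 = int p" by blast
  let ?h = "\<lambda>j z. (gauss_mult a b ^^ j) ((gauss_mult a (- b) ^^ (k - j)) z)"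
  have "card (two_squares (p ^ k * m)) \<le> card (\<Union>j\<le>k. ?h j ` two_squares m)"
    by (intro card_mono two_squares_split_prime p ab) (auto simp: finite_two_squares)
  also have "\<dots> \<le> (\<Sum>j\<le>k. card (?h j ` two_squares m))" by (rule card_UN_le) simp
  also have "\<dots> \<le> (\<Sum>j\<le>k. card (two_squares m))" by (intro sum_mono card_image_le finite_two_squares)
  finally show ?thesis by simp
next
  case inert: False
  have both: "\<exists>u v. x = int p * u \<and> y = int p * v" if "int p dvd x\<^sup>2 + y\<^sup>2" for x y
  proof -
    have "int p dvd y" using prime_sum_two_squaresI[OF p that] inert by blast
    moreover have "int p dvd x" using prime_sum_two_squaresI[OF p, of y x] that inert by (auto simp: add.commute)
    ultimately show ?thesis by (auto elim!: dvdE)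
  qed
  have p0: "p > 0" using p by (simp add: prime_gt_0_nat)
  have one: "two_squares (p * m) = {}"
  proof -
    have False if "x\<^sup>2 + y\<^sup>2 = int p * int m" for x y
    proof -
      from that both[of x y] obtain u v where "x = int p * u" "y = int p * v" by auto
      with that have "int p * (int p * (u\<^sup>2 + v\<^sup>2)) = int p * int m"
        by (simp add: power2_eq_square algebra_simps)
      then have "int p * (u\<^sup>2 + v\<^sup>2) = int m" using p0 by simp
      then have "int p dvd int m" by (metis dvd_triv_left)
      with m show False by simp
    qed
    then show ?thesis by (auto simp: two_squares_def)
  qed
  have two: "two_squares (p ^ Suc (Suc j) * m) \<subseteq> gauss_mult (int p) 0 ` two_squares (p ^ j * m)" for j
  proof clarify
    fix x y assume "(x, y) \<in> two_squares (p ^ Suc (Suc j) * m)"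
    then have n: "x\<^sup>2 + y\<^sup>2 = int p * (int p * int (p ^ j * m))" by (simp add: two_squares_def algebra_simps)
    with both[of x y] obtain u v where uv: "x = int p * u" "y = int p * v" by auto
    with n have "int p * (int p * (u\<^sup>2 + v\<^sup>2)) = int p * (int p * int (p ^ j * m))"
      by (simp add: power2_eq_square algebra_simps)
    then have "(u, v) \<in> two_squares (p ^ j * m)" using p0 by (simp add: two_squares_def)
    then show "(x, y) \<in> gauss_mult (int p) 0 ` two_squares (p ^ j * m)"
      by (intro image_eqI[of _ _ "(u, v)"]) (auto simp: uv gauss_mult_def)
  qed
  show ?thesis
  proof (induction k rule: less_induct)
    case (less k)
    consider "k = 0" | "k = 1" | j where "k = Suc (Suc j)"
      by (metis One_nat_def nat.exhaust)
    then show ?case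
    proof cases
      case 3
      have "card (two_squares (p ^ k * m)) \<le> card (gauss_mult (int p) 0 ` two_squares (p ^ j * m))"
        unfolding 3 by (intro card_mono two finite_imageI finite_two_squares)
      also have "\<dots> \<le> card (two_squares (p ^ j * m))" by (intro card_image_le finite_two_squares)
      also have "\<dots> \<le> (j + 1) * card (two_squares m)" using less[of j] 3 by simp
      also have "\<dots> \<le> (k + 1) * card (two_squares m)" using 3 by simp
      finally show ?thesis .
    qed (auto simp: one)
  qed
qed

text \<open>The factor \<open>k + 1\<close> contributed by a prime power \<open>p\<^sup>k\<close> is at most \<open>p\<close> to the power \<open>k \<epsilon>\<close> once
\<open>p \<ge> 2\<^sup>1\<^sup>/\<^sup>\<epsilon>\<close>. Each of the finitely many smaller primes costs at most a constant factor \<open>D\<close>.\<close>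

lemma card_two_squares_bound:
  fixes \<epsilon> :: real
  assumes "\<epsilon> > 0"
  shows "\<exists>C>0. \<forall>n\<ge>1. real (card (two_squares n)) \<le> C * real n powr \<epsilon>"
proof -
  define B where "B = 2 powr (1 / \<epsilon>)"
  define D where "D = 1 + 1 / (\<epsilon> * ln 2)"
  have D1: "D \<ge> 1" using assms by (simp add: D_def)
  have small: "real k + 1 \<le> D * real p powr (real k * \<epsilon>)" if "p \<ge> 2" for k p :: nat
  proof -
    have l: "real k * \<epsilon> * ln 2 \<le> real p powr (real k * \<epsilon>)"
    proof -
      have "real k * \<epsilon> * ln 2 \<le> exp (real k * \<epsilon> * ln 2)"
        using exp_ge_add_one_self[of "real k * \<epsilon> * ln 2"] by linarith
      also have "\<dots> = 2 powr (real k * \<epsilon>)" by (simp add: powr_def)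
      also have "\<dots> \<le> real p powr (real k * \<epsilon>)" using that assms by (intro powr_mono2) auto
      finally show ?thesis .
    qed
    have "1 \<le> real p powr (real k * \<epsilon>)" using that assms by (intro ge_one_powr_ge_zero) auto
    moreover have "real k \<le> (1 / (\<epsilon> * ln 2)) * real p powr (real k * \<epsilon>)"
      using l assms by (simp add: field_simps)
    ultimately show ?thesis by (simp add: D_def distrib_right)
  qed
  have large: "real k + 1 \<le> real p powr (real k * \<epsilon>)" if "real p \<ge> B" for k p :: nat
  proof -
    have "real k + 1 \<le> 2 ^ k" by (induction k) auto
    also have "\<dots> = (2 powr (1 / \<epsilon>)) powr (real k * \<epsilon>)"
      using assms by (simp add: powr_powr powr_realpow[symmetric])
    also have "\<dots> \<le> real p powr (real k * \<epsilon>)"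
      using that assms by (intro powr_mono2) (auto simp: B_def)
    finally show ?thesis .
  qed
  \<comment> \<open>removing the full power of one prime at a time, with one factor \<open>D\<close> for each prime below \<open>B\<close>\<close>
  have main: "real (card (two_squares n)) \<le>
     card (two_squares 1) * D ^ card {p. prime p \<and> p dvd n \<and> real p < B} * real n powr \<epsilon>" if "n \<ge> 1" for n
    using that
  proof (induction n rule: less_induct)
    case (less n)
    show ?case
    proof (cases "n = 1")
      case True
      have "{p. prime p \<and> p dvd Suc 0 \<and> real p < B} = {}" by (auto simp del: One_nat_def)
      then have none: "{p. prime p \<and> p dvd n \<and> real p < B} = {}" using True by simp
      show ?thesis unfolding none using True by simp
    next
      case False
      then obtain p where p: "prime p" "p dvd n" using less.prems prime_factor_nat by blast
      define k where "k = multiplicity p n"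
      obtain m where m: "n = p ^ k * m" "\<not> p dvd m"
        using multiplicity_decompose'[of n p] p less.prems unfolding k_def
        by (metis not_one_le_zero not_prime_unit)
      have p2: "p \<ge> 2" using p prime_ge_2_nat by blast
      have m1: "m \<ge> 1" using m less.prems by (cases m) auto
      have k1: "k > 0" using m p by (cases k) auto
      have mn: "m < n" using p2 k1 m1 m(1)
        by (metis One_nat_def Suc_le_lessD less_le_trans n_less_m_mult_n one_less_numeral_iff one_less_power semiring_norm(76))
      let ?S = "\<lambda>n. {q. prime q \<and> q dvd n \<and> real q < B}"
      have fin: "finite (?S n)" for n
        by (rule finite_subset[of _ "{..nat \<lceil>B\<rceil>}"]) (auto, linarith)
      have pw: "real n powr \<epsilon> = real p powr (real k * \<epsilon>) * real m powr \<epsilon>"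
        using p2 by (simp add: m(1) powr_mult powr_powr powr_realpow[symmetric])
      have "real (card (two_squares n)) \<le> (real k + 1) * real (card (two_squares m))"
        using card_two_squares_prime_power[OF p(1) m(2), of k] m(1)
        by (metis of_nat_1 of_nat_add of_nat_le_iff of_nat_mult)
      also have "\<dots> \<le> (real k + 1) * (card (two_squares 1) * D ^ card (?S m) * real m powr \<epsilon>)"
        using less.IH[OF mn m1] by (intro mult_left_mono) auto
      also have "\<dots> = (real k + 1) * D ^ card (?S m) * (card (two_squares 1) * real m powr \<epsilon>)" by simp
      also have "\<dots> \<le> (real p powr (real k * \<epsilon>) * D ^ card (?S n)) * (card (two_squares 1) * real m powr \<epsilon>)"
      proof (rule mult_right_mono)
        have sub: "?S m \<subseteq> ?S n" using m by auto
        show "(real k + 1) * D ^ card (?S m) \<le> real p powr (real k * \<epsilon>) * D ^ card (?S n)"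
        proof (cases "real p < B")
          case True
          have "insert p (?S m) \<subseteq> ?S n" using sub True p by auto
          then have "card (insert p (?S m)) \<le> card (?S n)" using fin by (rule card_mono[rotated])
          then have "Suc (card (?S m)) \<le> card (?S n)" using m(2) fin by simp
          then have "D ^ Suc (card (?S m)) \<le> D ^ card (?S n)" using D1 by (rule power_increasing)
          then have "real p powr (real k * \<epsilon>) * D ^ Suc (card (?S m)) \<le> real p powr (real k * \<epsilon>) * D ^ card (?S n)"
            by (rule mult_left_mono) simp
          moreover have "(real k + 1) * D ^ card (?S m) \<le> (D * real p powr (real k * \<epsilon>)) * D ^ card (?S m)"
            using small[OF p2] D1 by (intro mult_right_mono) auto
          ultimately show ?thesis by (simp add: mult_ac)
        next
          case False
          have "card (?S m) \<le> card (?S n)" using fin sub by (rule card_mono)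
          then show ?thesis using False large[of p k] D1
            by (intro mult_mono power_increasing) auto
        qed
      qed simp
      also have "\<dots> = card (two_squares 1) * D ^ card (?S n) * real n powr \<epsilon>" by (simp add: pw)
      finally show ?thesis .
    qed
  qed
  define b where "b = card {..nat \<lceil>B\<rceil>}"
  have "real (card (two_squares n)) \<le> (real (card (two_squares 1)) * D ^ b + 1) * real n powr \<epsilon>" if "n \<ge> 1" for n
  proof -
    have "card {p. prime p \<and> p dvd n \<and> real p < B} \<le> b"
      unfolding b_def by (rule card_mono) (auto, linarith)
    then have "D ^ card {p. prime p \<and> p dvd n \<and> real p < B} \<le> D ^ b" using D1 by (rule power_increasing)
    then have "card (two_squares 1) * D ^ card {p. prime p \<and> p dvd n \<and> real p < B} * real n powr \<epsilon>
        \<le> card (two_squares 1) * D ^ b * real n powr \<epsilon>"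
      by (intro mult_right_mono mult_left_mono) auto
    also have "\<dots> \<le> (real (card (two_squares 1)) * D ^ b + 1) * real n powr \<epsilon>"
      by (intro mult_right_mono) auto
    finally show ?thesis using main[OF that] by linarith
  qed
  moreover have "real (card (two_squares 1)) * D ^ b + 1 > 0" using D1 by (simp add: add_nonneg_pos)
  ultimately show ?thesis by blast
qed

section \<open>Lattice points on a circle\<close>

lemma norm_real2_power2: "(norm (v :: real ^ 2))\<^sup>2 = (v $ 1)\<^sup>2 + (v $ 2)\<^sup>2"
  unfolding power2_norm_eq_inner by (simp add: inner_vec_def sum_2 power2_eq_square)

text \<open>The product of the sides of a triangle is four times its area times the circumradius. Twice the area is
the absolute value of an integer determinant \<open>D\<close>, which is nonzero because a line meets a
circle in at most two points; the identity itself shows this, as its other side does not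
vanish.\<close>

lemma lattice_circle_triangle:
  assumes "\<xi> \<in> lattice_circle E" "\<eta> \<in> lattice_circle E" "\<zeta> \<in> lattice_circle E"
    and dist: "\<xi> \<noteq> \<eta>" "\<zeta> \<noteq> \<eta>" "\<xi> \<noteq> \<zeta>"
  shows "4 * real E \<le> (norm (\<xi> - \<eta>))\<^sup>2 * (norm (\<zeta> - \<eta>))\<^sup>2 * (norm (\<xi> - \<zeta>))\<^sup>2"
proof -
  define u1 u2 v1 v2 where uv: "u1 = \<xi> $ 1 - \<eta> $ 1" "u2 = \<xi> $ 2 - \<eta> $ 2" "v1 = \<zeta> $ 1 - \<eta> $ 1" "v2 = \<zeta> $ 2 - \<eta> $ 2"
  define D where "D = u1 * v2 - u2 * v1"
  have circ: "(\<xi> $ 1)\<^sup>2 + (\<xi> $ 2)\<^sup>2 = E" "(\<eta> $ 1)\<^sup>2 + (\<eta> $ 2)\<^sup>2 = E" "(\<zeta> $ 1)\<^sup>2 + (\<zeta> $ 2)\<^sup>2 = E"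
    using assms(1-3) by (simp_all add: lattice_circle_def norm_real2_power2)
  have \<alpha>: "2 * (\<eta> $ 1 * u1 + \<eta> $ 2 * u2) = - (u1\<^sup>2 + u2\<^sup>2)"
    and \<beta>: "2 * (\<eta> $ 1 * v1 + \<eta> $ 2 * v2) = - (v1\<^sup>2 + v2\<^sup>2)"
    using circ by (simp_all add: uv power2_eq_square algebra_simps)
  have cramer: "2 * D * \<eta> $ 1 = (v1\<^sup>2 + v2\<^sup>2) * u2 - (u1\<^sup>2 + u2\<^sup>2) * v2"
    "2 * D * \<eta> $ 2 = (u1\<^sup>2 + u2\<^sup>2) * v1 - (v1\<^sup>2 + v2\<^sup>2) * u1"
    using \<alpha> \<beta> unfolding D_def by algebra+
  have "4 * D\<^sup>2 * real E = (2 * D * \<eta> $ 1)\<^sup>2 + (2 * D * \<eta> $ 2)\<^sup>2"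
    unfolding circ(2)[symmetric] by (simp add: power2_eq_square algebra_simps)
  also have "\<dots> = (u1\<^sup>2 + u2\<^sup>2) * (v1\<^sup>2 + v2\<^sup>2) * ((u1 - v1)\<^sup>2 + (u2 - v2)\<^sup>2)"
    unfolding cramer by algebra
  also have "\<dots> = (norm (\<xi> - \<eta>))\<^sup>2 * (norm (\<zeta> - \<eta>))\<^sup>2 * (norm (\<xi> - \<zeta>))\<^sup>2"
    by (simp add: norm_real2_power2 uv)
  finally have eq: "4 * D\<^sup>2 * real E = (norm (\<xi> - \<eta>))\<^sup>2 * (norm (\<zeta> - \<eta>))\<^sup>2 * (norm (\<xi> - \<zeta>))\<^sup>2" .
  have "D \<in> \<int>"
    using assms(1-3) by (simp add: D_def uv lattice_circle_def integer_lattice_def)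
  moreover have "D \<noteq> 0" using eq dist by auto
  ultimately have "1 \<le> \<bar>D\<bar>" by (rule Ints_nonzero_abs_ge1)
  then have "1 \<le> D\<^sup>2" by (metis one_le_power power2_abs)
  then have "4 * 1 * real E \<le> 4 * D\<^sup>2 * real E" by (intro mult_right_mono mult_left_mono) auto
  then show ?thesis using eq by simp
qed

lemma lattice_circle_partner_unique:
  assumes circle: "\<xi> \<in> lattice_circle E" "\<eta> \<in> lattice_circle E" "\<zeta> \<in> lattice_circle E"
    and "\<eta> \<noteq> \<xi>" "\<zeta> \<noteq> \<xi>"
    and near: "norm (\<eta> - \<xi>) \<le> r" "norm (\<zeta> - \<xi>) \<le> r"
    and r: "r ^ 6 < real E"
  shows "\<eta> = \<zeta>"
proof (rule ccontr)
  assume "\<eta> \<noteq> \<zeta>"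
  have "norm (\<eta> - \<zeta>) \<le> 2 * r" using norm_triangle_ineq4[of "\<eta> - \<xi>" "\<zeta> - \<xi>"] near by simp
  have "4 * real E \<le> (norm (\<eta> - \<xi>))\<^sup>2 * (norm (\<zeta> - \<xi>))\<^sup>2 * (norm (\<eta> - \<zeta>))\<^sup>2"
    by (rule lattice_circle_triangle) fact+
  also have "\<dots> \<le> r\<^sup>2 * r\<^sup>2 * (2 * r)\<^sup>2"
    by (intro mult_mono power_mono) (use near \<open>norm (\<eta> - \<zeta>) \<le> 2 * r\<close> in auto)
  also have "\<dots> = 4 * r ^ 6" by (simp add: power_mult_distrib flip: power_add)
  finally show False using r by simp
qed

text \<open>Being within distance \<open>r\<close> relates a lattice point on the circle to at most one other, and the
relation is symmetric; \<open>\<sigma>\<close> maps a point to that neighbour, or to itself if there is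
none.\<close>

lemma lattice_circle_partner:
  assumes r: "r ^ 6 < real E"
  obtains \<sigma> where
    "\<And>\<xi>. \<xi> \<in> lattice_circle E \<Longrightarrow> \<sigma> \<xi> \<in> lattice_circle E"
    "\<And>\<xi>. \<xi> \<in> lattice_circle E \<Longrightarrow> \<sigma> (\<sigma> \<xi>) = \<xi>"
    "\<And>\<xi> \<eta>. \<xi> \<in> lattice_circle E \<Longrightarrow> \<eta> \<in> lattice_circle E \<Longrightarrow> \<eta> \<noteq> \<xi> \<Longrightarrow> \<eta> \<noteq> \<sigma> \<xi> \<Longrightarrow> r < norm (\<eta> - \<xi>)"
proof -
  define R where "R \<xi> \<eta> \<longleftrightarrow> \<eta> \<in> lattice_circle E \<and> \<eta> \<noteq> \<xi> \<and> norm (\<eta> - \<xi>) \<le> r" for \<xi> \<eta>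
  define \<sigma> where "\<sigma> \<xi> = (if \<exists>\<eta>. R \<xi> \<eta> then SOME \<eta>. R \<xi> \<eta> else \<xi>)" for \<xi>
  have R: "R \<xi> (\<sigma> \<xi>)" if "R \<xi> \<eta>" for \<xi> \<eta>
    using someI[of "R \<xi>" \<eta>] that by (auto simp: \<sigma>_def)
  have uniq: "\<sigma> \<xi> = \<eta>" if "\<xi> \<in> lattice_circle E" "R \<xi> \<eta>" for \<xi> \<eta>
    using lattice_circle_partner_unique[OF that(1) _ _ _ _ _ _ r, of "\<sigma> \<xi>" \<eta>] R[OF that(2)] that(2)
    by (simp add: R_def)
  have none: "\<sigma> \<xi> = \<xi>" if "\<not> (\<exists>\<eta>. R \<xi> \<eta>)" for \<xi>
    using that by (simp add: \<sigma>_def)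
  show thesis
  proof (rule that[of \<sigma>])
    fix \<xi> assume \<xi>: "\<xi> \<in> lattice_circle E"
    show "\<sigma> \<xi> \<in> lattice_circle E"
      using R[of \<xi>] none[of \<xi>] \<xi> by (metis R_def)
    show "\<sigma> (\<sigma> \<xi>) = \<xi>"
    proof (cases "\<exists>\<eta>. R \<xi> \<eta>")
      case True
      then have "R \<xi> (\<sigma> \<xi>)" using R by blast
      then have "R (\<sigma> \<xi>) \<xi>" using \<xi> by (auto simp: R_def norm_minus_commute)
      then show ?thesis using \<open>R \<xi> (\<sigma> \<xi>)\<close> by (intro uniq) (auto simp: R_def)
    next
      case False then show ?thesis using none by metis
    qed
    fix \<eta> assume "\<eta> \<in> lattice_circle E" "\<eta> \<noteq> \<xi>" "\<eta> \<noteq> \<sigma> \<xi>"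
    then show "r < norm (\<eta> - \<xi>)" using uniq[OF \<xi>, of \<eta>] by (force simp: R_def)
  qed
qed

lemma card_lattice_circle_le: "card (lattice_circle E) \<le> card (two_squares E)"
proof (rule card_inj_on_le)
  let ?f = "\<lambda>\<xi> :: real ^ 2. (\<lfloor>\<xi> $ 1\<rfloor>, \<lfloor>\<xi> $ 2\<rfloor>)"
  have int: "real_of_int \<lfloor>\<xi> $ i\<rfloor> = \<xi> $ i" if "\<xi> \<in> lattice_circle E" for \<xi> i
    using that by (auto simp: lattice_circle_def integer_lattice_def of_int_floor)
  show "inj_on ?f (lattice_circle E)"
  proof (rule inj_onI)
    fix \<xi> \<eta> assume *: "\<xi> \<in> lattice_circle E" "\<eta> \<in> lattice_circle E" "?f \<xi> = ?f \<eta>"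
    then have "\<lfloor>\<xi> $ 1\<rfloor> = \<lfloor>\<eta> $ 1\<rfloor>" "\<lfloor>\<xi> $ 2\<rfloor> = \<lfloor>\<eta> $ 2\<rfloor>" by simp_all
    then have "\<xi> $ 1 = \<eta> $ 1" "\<xi> $ 2 = \<eta> $ 2"
      using int[OF *(1)] int[OF *(2)] by metis+
    then show "\<xi> = \<eta>" by (simp add: vec_eq_iff forall_2)
  qed
  show "?f ` lattice_circle E \<subseteq> two_squares E"
  proof clarify
    fix \<xi> assume \<xi>: "\<xi> \<in> lattice_circle E"
    have "real_of_int (\<lfloor>\<xi> $ 1\<rfloor>\<^sup>2 + \<lfloor>\<xi> $ 2\<rfloor>\<^sup>2) = real_of_int (int E)"
      unfolding of_int_add of_int_power int[OF \<xi>]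
      using \<xi> by (simp add: lattice_circle_def norm_real2_power2)
    then show "(\<lfloor>\<xi> $ 1\<rfloor>, \<lfloor>\<xi> $ 2\<rfloor>) \<in> two_squares E"
      unfolding two_squares_def of_int_eq_iff by simp
  qed
qed (rule finite_two_squares)

section \<open>Moving frame and width of a regular arc\<close>

lemma width_le:
  assumes "compact \<Gamma>" "\<Gamma> \<noteq> {}" and u: "norm u = 1"
    and strip: "\<And>x. x \<in> \<Gamma> \<Longrightarrow> \<bar>u \<bullet> x - c\<bar> \<le> B"
  shows "width \<Gamma> \<le> 2 * B"
proof -
  have cont: "continuous_on \<Gamma> (\<lambda>x. u \<bullet> x)" by (intro continuous_intros)
  \<comment> \<open>the supporting lines with outer normals \<open>u\<close> and \<open>- u\<close> pass through \<open>a\<close> and \<open>b\<close>\<close>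
  obtain a where a: "a \<in> \<Gamma>" "\<And>x. x \<in> \<Gamma> \<Longrightarrow> u \<bullet> x \<le> u \<bullet> a"
    using continuous_attains_sup[OF assms(1,2) cont] by blast
  obtain b where b: "b \<in> \<Gamma>" "\<And>x. x \<in> \<Gamma> \<Longrightarrow> u \<bullet> b \<le> u \<bullet> x"
    using continuous_attains_inf[OF assms(1,2) cont] by blast
  define L M where LM: "L = {x. u \<bullet> x = u \<bullet> a}" "M = {x. (- u) \<bullet> x = (- u) \<bullet> b}"
  have supp: "supporting_line \<Gamma> u L" "supporting_line \<Gamma> (- u) M"
    unfolding supporting_line_def LM using u a b by auto
  have uu: "u \<bullet> u = 1" using u by (simp add: dot_square_norm)
  have "width \<Gamma> \<le> setdist L M"
    unfolding width_def
  proof (rule cInf_lower)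
    show "bdd_below {setdist L M |L M. \<exists>u. supporting_line \<Gamma> u L \<and> supporting_line \<Gamma> (- u) M}"
      by (rule bdd_belowI[of _ 0]) (auto simp: setdist_pos_le)
  qed (use supp in blast)
  also have "\<dots> \<le> dist a (a - (u \<bullet> a - u \<bullet> b) *\<^sub>R u)"
    by (rule setdist_le_dist) (auto simp: LM inner_diff_right uu)
  also have "\<dots> = u \<bullet> a - u \<bullet> b" using u a(2)[OF b(1)] by (simp add: dist_norm)
  also have "\<dots> \<le> 2 * B" using strip[OF a(1)] strip[OF b(1)] by linarith
  finally show ?thesis .
qed

lemma has_real_derivative_inner:
  assumes "(f has_vector_derivative f') (at t within S)"
  shows "((\<lambda>t. f t \<bullet> v) has_real_derivative f' \<bullet> v) (at t within S)"
  using bounded_linear.has_vector_derivative[OF bounded_linear_inner_left assms]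
  by (simp add: has_real_derivative_iff_has_vector_derivative)

text \<open>\<open>T\<close> is the initial tangent and \<open>N\<close> the normal on the side to which the arc bends. Since the
speed is constant, \<open>\<gamma>''\<close> is \<open>c\<close> times the rotated velocity, with \<open>|c| = |\<gamma>''|\<close>; so its
components are \<open>-c y'\<close> and \<open>c x'\<close>, which gives the bounds on both accelerations. A tenth
of the arc is short enough for the turning angle required of a slightly curved arc.\<close>

lemma regular_arc_frame:
  assumes "regular_parametrization l \<gamma>"
  obtains T N :: "real ^ 2" and x' x'' y' y'' and \<kappa> :: real
  where "norm N = 1" "\<And>v w. v \<bullet> w = (v \<bullet> T) * (w \<bullet> T) + (v \<bullet> N) * (w \<bullet> N)"
    and "curved_arc (\<lambda>t. (\<gamma> t - \<gamma> 0) \<bullet> T) x' x'' (\<lambda>t. (\<gamma> t - \<gamma> 0) \<bullet> N) y' y'' (l / 10) \<kappa>"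
    and "\<And>t. t \<in> {0..l} \<Longrightarrow> \<bar>(\<gamma> t - \<gamma> 0) \<bullet> N\<bar> \<le> 2 * \<kappa> * l\<^sup>2"
proof -
  from assms obtain \<gamma>' \<gamma>'' \<kappa> where l: "0 < l" "l < 1"
    and d1: "\<And>t. t \<in> {0..l} \<Longrightarrow> (\<gamma> has_vector_derivative \<gamma>' t) (at t within {0..l})"
    and d2: "\<And>t. t \<in> {0..l} \<Longrightarrow> (\<gamma>' has_vector_derivative \<gamma>'' t) (at t within {0..l})"
    and cont: "continuous_on {0..l} \<gamma>''"
    and unit: "\<And>t. t \<in> {0..l} \<Longrightarrow> norm (\<gamma>' t) = 1"
    and \<kappa>: "\<kappa> > 0" "\<And>t. t \<in> {0..l} \<Longrightarrow> \<kappa> < norm (\<gamma>'' t)" "\<And>t. t \<in> {0..l} \<Longrightarrow> norm (\<gamma>'' t) < 2 * \<kappa>"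
      "2 * \<kappa> * l < 1"
    unfolding regular_parametrization_def by blast
  define T where "T = \<gamma>' 0"
  define N\<^sub>0 :: "real ^ 2" where "N\<^sub>0 = vector [- (T $ 2), T $ 1]"
  define N where "N = (if 0 \<le> \<gamma>'' 0 \<bullet> N\<^sub>0 then N\<^sub>0 else - N\<^sub>0)"
  have 0: "0 \<in> {0..l}" using l by simp
  have TT: "(T $ 1)\<^sup>2 + (T $ 2)\<^sup>2 = 1" using unit[OF 0] norm_real2_power2[of T] by (simp add: T_def)
  have frame\<^sub>0: "v \<bullet> w = (v \<bullet> T) * (w \<bullet> T) + (v \<bullet> N\<^sub>0) * (w \<bullet> N\<^sub>0)" for v w
  proof -
    have "(v \<bullet> T) * (w \<bullet> T) + (v \<bullet> N\<^sub>0) * (w \<bullet> N\<^sub>0) = ((T $ 1)\<^sup>2 + (T $ 2)\<^sup>2) * (v \<bullet> w)"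
      by (simp add: N\<^sub>0_def inner_vec_def sum_2 power2_eq_square algebra_simps)
    then show ?thesis by (simp add: TT)
  qed
  have frame: "v \<bullet> w = (v \<bullet> T) * (w \<bullet> T) + (v \<bullet> N) * (w \<bullet> N)" for v w
    using frame\<^sub>0[of v w] by (simp add: N_def)
  have "(norm N\<^sub>0)\<^sup>2 = 1" using TT by (simp add: norm_real2_power2 N\<^sub>0_def)
  then have "norm N\<^sub>0 = 1" by (simp add: power2_eq_1_iff) (metis norm_ge_zero not_one_le_zero neg_0_le_iff_le)
  then have N1: "norm N = 1" by (simp add: N_def)
  have TN: "T \<bullet> N = 0" by (simp add: N_def N\<^sub>0_def inner_vec_def sum_2)
  define x' y' x'' y'' where xy: "x' = (\<lambda>t. \<gamma>' t \<bullet> T)" "y' = (\<lambda>t. \<gamma>' t \<bullet> N)" "x'' = (\<lambda>t. \<gamma>'' t \<bullet> T)" "y'' = (\<lambda>t. \<gamma>'' t \<bullet> N)"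
  have dx: "((\<lambda>t. (\<gamma> t - \<gamma> 0) \<bullet> v) has_real_derivative \<gamma>' t \<bullet> v) (at t within {0..l})" if "t \<in> {0..l}" for t v
    using has_real_derivative_inner[OF d1[OF that], of v]
    by (auto intro!: derivative_eq_intros simp: inner_diff_left)
  have dx': "((\<lambda>t. \<gamma>' t \<bullet> v) has_real_derivative \<gamma>'' t \<bullet> v) (at t within {0..l})" if "t \<in> {0..l}" for t v
    using has_real_derivative_inner[OF d2[OF that], of v] .
  have speed: "(x' t)\<^sup>2 + (y' t)\<^sup>2 = 1" if "t \<in> {0..l}" for t
    using frame[of "\<gamma>' t" "\<gamma>' t"] unit[OF that] by (simp add: xy power2_eq_square dot_square_norm)
  have acc: "(x'' t)\<^sup>2 + (y'' t)\<^sup>2 = (norm (\<gamma>'' t))\<^sup>2" for t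
    unfolding power2_norm_eq_inner using frame[of "\<gamma>'' t" "\<gamma>'' t"] by (simp add: xy power2_eq_square)
  have orth: "x' t * x'' t + y' t * y'' t = 0" if t: "t \<in> {0..l}" for t
  proof -
    have "((\<lambda>t. \<gamma>' t \<bullet> \<gamma>' t) has_vector_derivative (\<gamma>' t \<bullet> \<gamma>'' t + \<gamma>'' t \<bullet> \<gamma>' t)) (at t within {0..l})"
      by (rule bounded_bilinear.has_vector_derivative[OF bounded_bilinear_inner d2[OF t] d2[OF t]])
    moreover have "((\<lambda>t. \<gamma>' t \<bullet> \<gamma>' t) has_vector_derivative 0) (at t within {0..l})"
    proof (rule has_vector_derivative_transform[OF t])
      show "((\<lambda>t. 1 :: real) has_vector_derivative 0) (at t within {0..l})" by simp
      show "\<gamma>' s \<bullet> \<gamma>' s = 1" if "s \<in> {0..l}" for s using unit[OF that] by (simp add: dot_square_norm)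
    qed
    ultimately have "\<gamma>' t \<bullet> \<gamma>'' t + \<gamma>'' t \<bullet> \<gamma>' t = 0"
      by (rule vector_derivative_unique_within_closed_interval[where a = 0 and b = l and x = t,
            unfolded box_real, OF l(1) t])
    then have "\<gamma>' t \<bullet> \<gamma>'' t = 0" by (simp add: inner_commute)
    then show ?thesis using frame[of "\<gamma>' t" "\<gamma>'' t"] by (simp add: xy)
  qed
  have comp: "\<bar>v \<bullet> T\<bar> \<le> norm v" "\<bar>v \<bullet> N\<bar> \<le> norm v" for v
    using Cauchy_Schwarz_ineq2[of v T] Cauchy_Schwarz_ineq2[of v N] N1 unit[OF 0] by (simp_all add: T_def)
  have y'_le: "\<bar>y' t\<bar> \<le> 2 * \<kappa> * t" if t: "t \<in> {0..l}" for t
  proof -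
    have "\<bar>y' t - y' 0\<bar> \<le> 2 * \<kappa> * (t - 0)"
      unfolding xy
    proof (rule abs_increment_le[OF dx'])
      show "\<bar>\<gamma>'' w \<bullet> N\<bar> \<le> 2 * \<kappa>" if "w \<in> {0..t}" for w
        using comp(2)[of "\<gamma>'' w"] \<kappa>(3)[of w] that t by simp
    qed (use t in auto)
    then show ?thesis using TN by (simp add: xy T_def)
  qed
  have strip: "\<bar>(\<gamma> t - \<gamma> 0) \<bullet> N\<bar> \<le> 2 * \<kappa> * l\<^sup>2" if t: "t \<in> {0..l}" for t
  proof -
    have "\<bar>(\<gamma> t - \<gamma> 0) \<bullet> N - (\<gamma> 0 - \<gamma> 0) \<bullet> N\<bar> \<le> (2 * \<kappa> * l) * (t - 0)"
    proof (rule abs_increment_le[OF dx])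
      fix w assume w: "w \<in> {0..t}"
      have "2 * \<kappa> * w \<le> 2 * \<kappa> * l" using w t \<kappa>(1) by simp
      then show "\<bar>\<gamma>' w \<bullet> N\<bar> \<le> 2 * \<kappa> * l" using y'_le[of w] w t by (simp add: xy)
    qed (use t in auto)
    also have "\<dots> \<le> (2 * \<kappa> * l) * l" using t l \<kappa>(1) by (intro mult_left_mono) auto
    finally show ?thesis by (simp add: power2_eq_square)
  qed
  define r where "r = l / 10"
  have r: "0 < r" "r \<le> l" "\<kappa> * r \<le> 1 / 20" using l \<kappa>(4) by (auto simp: r_def)
  have sub: "{0..r} \<subseteq> {0..l}" using r by auto
  have x'_ge: "9 / 10 \<le> x' t" if t: "t \<in> {0..r}" for t
  proof -
    have "\<bar>x' t - x' 0\<bar> \<le> 2 * \<kappa> * (t - 0)"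
      unfolding xy
    proof (rule abs_increment_le[OF dx'])
      show "\<bar>\<gamma>'' w \<bullet> T\<bar> \<le> 2 * \<kappa>" if "w \<in> {0..t}" for w
        using comp(1)[of "\<gamma>'' w"] \<kappa>(3)[of w] that t r by simp
    qed (use t r in auto)
    moreover have "x' 0 = 1" using unit[OF 0] by (simp add: xy T_def dot_square_norm)
    moreover have "\<kappa> * t \<le> \<kappa> * r" using t \<kappa>(1) by simp
    ultimately show ?thesis using r(3) by simp
  qed
  have x'_le: "x' t \<le> 1" if "t \<in> {0..l}" for t
    using comp(1)[of "\<gamma>' t"] unit[OF that] by (simp add: xy)
  \<comment> \<open>the signed curvature\<close>
  define c where "c t = y'' t * x' t - x'' t * y' t" for t
  have c: "x'' t = - c t * y' t" "y'' t = c t * x' t" "\<bar>c t\<bar> = norm (\<gamma>'' t)" if t: "t \<in> {0..l}" for t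
  proof -
    show 1: "x'' t = - c t * y' t" using orth[OF t] speed[OF t] unfolding c_def by algebra
    show 2: "y'' t = c t * x' t" using orth[OF t] speed[OF t] unfolding c_def by algebra
    have "(c t)\<^sup>2 = (norm (\<gamma>'' t))\<^sup>2"
      using acc[of t] speed[OF t] unfolding 1 2 by algebra
    then show "\<bar>c t\<bar> = norm (\<gamma>'' t)" by (metis norm_ge_zero abs_of_nonneg power2_eq_iff abs_minus_cancel)
  qed
  have x''_le: "\<bar>x'' t\<bar> \<le> 4 * \<kappa>\<^sup>2 * t" if t: "t \<in> {0..l}" for t
  proof -
    have "\<bar>c t\<bar> * \<bar>y' t\<bar> \<le> (2 * \<kappa>) * (2 * \<kappa> * t)"
      using c(3)[OF t] \<kappa>(3)[OF t] y'_le[OF t] \<kappa>(1) by (intro mult_mono) auto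
    then show ?thesis using c(1)[OF t] by (simp add: abs_mult power2_eq_square)
  qed
  have y''_abs: "9 / 10 * \<kappa> \<le> \<bar>y'' t\<bar>" if t: "t \<in> {0..r}" for t
  proof -
    have "\<kappa> * (9 / 10) \<le> \<bar>c t\<bar> * \<bar>x' t\<bar>"
      using c(3)[of t] \<kappa>(1) \<kappa>(2)[of t] x'_ge[OF t] t r by (intro mult_mono) auto
    then show ?thesis using c(2)[of t] t r by (simp add: abs_mult)
  qed
  have cy: "continuous_on {0..l} y''" "continuous_on {0..l} x''"
    unfolding xy by (intro continuous_intros cont)+
  have y''_0: "0 \<le> y'' 0" by (auto simp: xy N_def)
  have y''_ge: "9 / 10 * \<kappa> \<le> y'' t" if t: "t \<in> {0..r}" for t
  proof (cases "0 \<le> y'' t")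
    case True then show ?thesis using y''_abs[OF t] by simp
  next
    case False
    have "continuous_on {0..t} y''" using t r by (intro continuous_on_subset[OF cy(1)]) auto
    then obtain s where "0 \<le> s" "s \<le> t" "y'' s = 0"
      using IVT2'[of y'' t 0 0] False y''_0 t by auto
    then show ?thesis using y''_abs[of s] t \<kappa>(1) by auto
  qed
  have y''_le: "y'' t \<le> 2 * \<kappa>" if "t \<in> {0..l}" for t
    using comp(2)[of "\<gamma>'' t"] \<kappa>(3)[OF that] by (simp add: xy)
  have "curved_arc (\<lambda>t. (\<gamma> t - \<gamma> 0) \<bullet> T) x' x'' (\<lambda>t. (\<gamma> t - \<gamma> 0) \<bullet> N) y' y'' r \<kappa>"
  proof unfold_locales
    fix t assume t: "t \<in> {0..r}"
    then have tl: "t \<in> {0..l}" using sub by auto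
    show "((\<lambda>t. (\<gamma> t - \<gamma> 0) \<bullet> T) has_real_derivative x' t) (at t within {0..r})"
      "((\<lambda>t. (\<gamma> t - \<gamma> 0) \<bullet> N) has_real_derivative y' t) (at t within {0..r})"
      unfolding xy by (rule DERIV_subset[OF dx[OF tl] sub])+
    show "(x' has_real_derivative x'' t) (at t within {0..r})"
      "(y' has_real_derivative y'' t) (at t within {0..r})"
      unfolding xy by (rule DERIV_subset[OF dx'[OF tl] sub])+
    show "9 / 10 \<le> x' t" "x' t \<le> 1" "\<bar>y' t\<bar> \<le> 2 * \<kappa> * t" "\<bar>x'' t\<bar> \<le> 4 * \<kappa>\<^sup>2 * t"
      "9 / 10 * \<kappa> \<le> y'' t" "y'' t \<le> 2 * \<kappa>"
      using t tl by (intro x'_ge x'_le y'_le x''_le y''_ge y''_le; simp)+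
  qed (use r \<kappa>(1) continuous_on_subset[OF cy(1) sub] continuous_on_subset[OF cy(2) sub] in auto)
  then show thesis using that[OF N1 frame _ strip] by (simp add: r_def)
qed

lemma regular_arc_width_le:
  assumes frame: "norm N = 1"
    and arc: "regular_parametrization l \<gamma>"
    and strip: "\<And>t. t \<in> {0..l} \<Longrightarrow> \<bar>(\<gamma> t - \<gamma> 0) \<bullet> N\<bar> \<le> B"
  shows "width (\<gamma> ` {0..l}) \<le> 2 * B"
proof (rule width_le[OF _ _ frame])
  from arc obtain \<gamma>' where l: "0 < l"
    and "\<And>t. t \<in> {0..l} \<Longrightarrow> (\<gamma> has_vector_derivative \<gamma>' t) (at t within {0..l})"
    unfolding regular_parametrization_def by blast
  then have "continuous_on {0..l} \<gamma>"
    unfolding continuous_on_eq_continuous_within using has_vector_derivative_continuous by blast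
  then show "compact (\<gamma> ` {0..l})" by (intro compact_continuous_image) auto
  show "\<gamma> ` {0..l} \<noteq> {}" using l by simp
  show "\<bar>N \<bullet> x - N \<bullet> \<gamma> 0\<bar> \<le> B" if "x \<in> \<gamma> ` {0..l}" for x
  proof -
    from that obtain t where "t \<in> {0..l}" "x = \<gamma> t" by blast
    then show ?thesis using strip[of t] by (simp only: inner_diff_left inner_commute[of N])
  qed
qed

section \<open>Nodal arcs\<close>

lemma e_eq_cis: "e t = cis (2 * pi * t)"
  by (simp add: e_def cis_conv_exp mult_ac)

text \<open>Vanishing of the eigenfunction along the arc is a linear relation between the waves of the lattice
points, with coefficients twisted by the phases at the starting point. If the sagitta
\<open>\<kappa> l\<^sup>2\<close> were larger, the relation would be trivial, and so would the eigenfunction.\<close>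

lemma nodal_arc_bending_le:
  assumes \<phi>: "eigenfunction E \<phi>" and E: "1 \<le> E" and r: "0 < r" "r ^ 6 < real E"
    and nodal: "\<And>t. t \<in> {0..l} \<Longrightarrow> \<phi> (abs_torus (\<gamma> t)) = 0"
    and frame: "\<And>v w. v \<bullet> w = (v \<bullet> T) * (w \<bullet> T) + (v \<bullet> N) * (w \<bullet> N)"
    and arc: "curved_arc (\<lambda>t. (\<gamma> t - \<gamma> 0) \<bullet> T) x' x'' (\<lambda>t. (\<gamma> t - \<gamma> 0) \<bullet> N) y' y'' l \<kappa>"
  shows "sqrt (r * (\<kappa> * l\<^sup>2)) \<le> 10 ^ 28 * real (card (lattice_circle E))"
proof (rule ccontr)
  assume "\<not> ?thesis"
  then have big: "10 ^ 28 * real (card (lattice_circle E)) < sqrt (r * (\<kappa> * l\<^sup>2))" by simp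
  interpret curved_arc "\<lambda>t. (\<gamma> t - \<gamma> 0) \<bullet> T" x' x'' "\<lambda>t. (\<gamma> t - \<gamma> 0) \<bullet> N" y' y'' l \<kappa> by fact
  obtain a where sum: "\<And>x. complex_of_real (\<phi> (abs_torus x)) = (\<Sum>\<xi>\<in>lattice_circle E. a \<xi> * e (x \<bullet> \<xi>))"
    using \<phi> unfolding eigenfunction_def by blast
  obtain \<sigma> where \<sigma>: "\<And>\<xi>. \<xi> \<in> lattice_circle E \<Longrightarrow> \<sigma> \<xi> \<in> lattice_circle E"
    "\<And>\<xi>. \<xi> \<in> lattice_circle E \<Longrightarrow> \<sigma> (\<sigma> \<xi>) = \<xi>"
    "\<And>\<xi> \<eta>. \<xi> \<in> lattice_circle E \<Longrightarrow> \<eta> \<in> lattice_circle E \<Longrightarrow> \<eta> \<noteq> \<xi> \<Longrightarrow> \<eta> \<noteq> \<sigma> \<xi> \<Longrightarrow> r < norm (\<eta> - \<xi>)"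
    using lattice_circle_partner[OF r(2)] by blast
  have osc_ge: "norm v * (\<kappa> * l\<^sup>2) \<le> osc (v \<bullet> T) (v \<bullet> N)" for v
  proof -
    have "norm v = sqrt ((v \<bullet> T)\<^sup>2 + (v \<bullet> N)\<^sup>2)"
      unfolding norm_eq_sqrt_inner using frame[of v v] by (simp only: power2_eq_square)
    then have "norm v \<le> \<bar>v \<bullet> T\<bar> + \<bar>v \<bullet> N\<bar>"
      using sqrt_sum_squares_le_sum_abs by simp
    then have "norm v * (\<kappa> * l\<^sup>2) \<le> (\<bar>v \<bullet> T\<bar> + \<bar>v \<bullet> N\<bar>) * (\<kappa> * l\<^sup>2)"
      using \<kappa>_pos by (intro mult_right_mono) auto
    moreover have "\<bar>v \<bullet> T\<bar> * (\<kappa> * l\<^sup>2) \<le> \<bar>v \<bullet> T\<bar> * l"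
      using mult_right_mono[of "\<kappa> * l" 1 l] turn l_pos
      by (intro mult_left_mono) (auto simp: power2_eq_square mult_ac)
    ultimately show ?thesis by (simp add: osc_def distrib_right mult.assoc)
  qed
  define b where "b \<xi> = a \<xi> * e (\<gamma> 0 \<bullet> \<xi>)" for \<xi>
  have "b \<xi> = 0" if \<xi>: "\<xi> \<in> lattice_circle E" for \<xi>
  proof (rule no_vanishing_wave_sum[where P = "\<lambda>\<xi>. \<xi> \<bullet> T" and Q = "\<lambda>\<xi>. \<xi> \<bullet> N" and \<sigma> = \<sigma>,
        OF finite_lattice_circle \<sigma>(1,2) _ _ big _ \<xi>])
    fix \<xi> assume "\<xi> \<in> lattice_circle E" "\<sigma> \<xi> \<noteq> \<xi>"
    then have "0 < norm (\<sigma> \<xi> - \<xi>) * (\<kappa> * l\<^sup>2)" using \<kappa>_pos l_pos by simp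
    then show "0 < osc (\<sigma> \<xi> \<bullet> T - \<xi> \<bullet> T) (\<sigma> \<xi> \<bullet> N - \<xi> \<bullet> N)"
      using osc_ge[of "\<sigma> \<xi> - \<xi>"] by (simp add: inner_diff_left)
  next
    fix \<xi> \<eta> assume "\<xi> \<in> lattice_circle E" "\<eta> \<in> lattice_circle E" "\<eta> \<noteq> \<xi>" "\<eta> \<noteq> \<sigma> \<xi>"
    then have "r * (\<kappa> * l\<^sup>2) \<le> norm (\<eta> - \<xi>) * (\<kappa> * l\<^sup>2)"
      using \<sigma>(3)[of \<xi> \<eta>] \<kappa>_pos by (intro mult_right_mono) auto
    then show "r * (\<kappa> * l\<^sup>2) \<le> osc (\<eta> \<bullet> T - \<xi> \<bullet> T) (\<eta> \<bullet> N - \<xi> \<bullet> N)"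
      using osc_ge[of "\<eta> - \<xi>"] by (simp add: inner_diff_left)
  next
    fix t assume t: "t \<in> {0..l}"
    have "e (\<gamma> t \<bullet> \<xi>) = e (\<gamma> 0 \<bullet> \<xi>) * wave (\<xi> \<bullet> T) (\<xi> \<bullet> N) t" for \<xi>
    proof -
      have "\<gamma> t \<bullet> \<xi> = \<gamma> 0 \<bullet> \<xi> + phase (\<xi> \<bullet> T) (\<xi> \<bullet> N) t"
        unfolding phase_def using frame[of "\<gamma> t - \<gamma> 0" \<xi>] by (simp add: inner_diff_left algebra_simps)
      then show ?thesis unfolding wave_def e_eq_cis cis_mult by (simp only: distrib_left)
    qed
    then show "(\<Sum>\<xi>\<in>lattice_circle E. b \<xi> * wave (\<xi> \<bullet> T) (\<xi> \<bullet> N) t) = 0"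
      using sum[of "\<gamma> t"] nodal[OF t] by (simp add: b_def mult.assoc)
  qed
  then have a0: "a \<xi> = 0" if "\<xi> \<in> lattice_circle E" for \<xi>
    using that by (simp add: b_def e_eq_cis cis_neq_zero)
  have "\<phi> p = 0" for p
  proof (induction p rule: torus.abs_induct)
    case (1 x)
    show ?case using sum[of x] a0 by simp
  qed
  then show False using \<phi> unfolding eigenfunction_def by blast
qed

theorem theorem1:
  "\<forall>\<epsilon>::real. \<epsilon> > 0 \<longrightarrow> (\<exists>K::real. K > 0 \<and>
     (\<forall>(E::nat) (lam::real) (\<phi> :: torus \<Rightarrow> real) (C :: torus set) (\<Gamma> :: (real ^ 2) set).
        E \<ge> 1 \<and> lam > 0 \<and> real E = lam\<^sup>2 \<and> eigenfunction E \<phi> \<and>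
        regular_arc C \<and> C \<subseteq> nodal_set \<phi> \<and> regular_lift C \<Gamma> \<longrightarrow>
        width \<Gamma> < K * lam powr (- 1 / 3 + \<epsilon>)))"
proof (intro allI impI)
  fix \<epsilon> :: real assume \<epsilon>: "\<epsilon> > 0"
  obtain A where A: "A > 0" "\<And>n. n \<ge> 1 \<Longrightarrow> real (card (two_squares n)) \<le> A * real n powr (\<epsilon> / 4)"
    using card_two_squares_bound[of "\<epsilon> / 4"] \<epsilon> by auto
  \<comment> \<open>the exponent \<open>\<epsilon> / 4\<close> of \<open>E\<close> becomes \<open>\<epsilon>\<close> since \<open>E = lam\<^sup>2\<close> and the count enters squared\<close>
  define X where "X = (10 ^ 28 * A)\<^sup>2"
  \<comment> \<open>the width is at most four times the sagitta, which will be at most \<open>200 X\<close> times the power of \<open>lam\<close>\<close>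
  define K where "K = 1000 * X"
  have K: "K > 0" using A by (simp add: K_def X_def)
  have bound: "width \<Gamma> < K * lam powr (- 1 / 3 + \<epsilon>)"
    if E: "E \<ge> 1" "lam > 0" "real E = lam\<^sup>2" and \<phi>: "eigenfunction E \<phi>"
      and nodal: "C \<subseteq> nodal_set \<phi>" and lift: "regular_lift C \<Gamma>" for E lam \<phi> C \<Gamma>
  proof -
    from lift obtain l \<gamma> where \<gamma>: "regular_parametrization l \<gamma>" "\<Gamma> = \<gamma> ` {0..l}" "C = abs_torus ` \<Gamma>"
      unfolding regular_lift_def by blast
    have l: "0 < l" using \<gamma>(1) by (simp add: regular_parametrization_def)
    obtain T N x' x'' y' y'' \<kappa> where N: "norm N = 1"
      and frame: "\<And>v w. v \<bullet> w = (v \<bullet> T) * (w \<bullet> T) + (v \<bullet> N) * (w \<bullet> N)"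
      and arc: "curved_arc (\<lambda>t. (\<gamma> t - \<gamma> 0) \<bullet> T) x' x'' (\<lambda>t. (\<gamma> t - \<gamma> 0) \<bullet> N) y' y'' (l / 10) \<kappa>"
      and strip: "\<And>t. t \<in> {0..l} \<Longrightarrow> \<bar>(\<gamma> t - \<gamma> 0) \<bullet> N\<bar> \<le> 2 * \<kappa> * l\<^sup>2"
      by (rule regular_arc_frame[OF \<gamma>(1)]) (rule that; assumption)
    have wid: "width \<Gamma> \<le> 2 * (2 * \<kappa> * l\<^sup>2)"
      unfolding \<gamma>(2) by (rule regular_arc_width_le[OF N \<gamma>(1) strip])
    \<comment> \<open>\<open>2 r\<close> is below \<open>(2 lam)\<^sup>1\<^sup>/\<^sup>3\<close>, so three points cannot be pairwise that close\<close>
    define r where "r = lam powr (1 / 3) / 2"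
    have r0: "r > 0" using E by (simp add: r_def)
    have "r ^ 6 = lam\<^sup>2 / 64"
      using E(2) by (simp add: r_def power_divide powr_power)
    then have r6: "r ^ 6 < real E" using E by simp
    have "\<phi> (abs_torus (\<gamma> t)) = 0" if "t \<in> {0..l / 10}" for t
    proof -
      have "t \<in> {0..l}" using that l by simp
      then have "abs_torus (\<gamma> t) \<in> C" unfolding \<gamma>(2,3) by (intro imageI)
      then show ?thesis using nodal by (auto simp: nodal_set_def)
    qed
    then have "sqrt (r * (\<kappa> * (l / 10)\<^sup>2)) \<le> 10 ^ 28 * real (card (lattice_circle E))"
      by (rule nodal_arc_bending_le[where \<gamma> = \<gamma> and l = "l / 10", OF \<phi> E(1) r0 r6 _ frame arc])
    also have "\<dots> \<le> 10 ^ 28 * (A * real E powr (\<epsilon> / 4))"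
      using card_lattice_circle_le[of E] A(2)[OF E(1)] by (intro mult_left_mono) auto
    also have "real E powr (\<epsilon> / 4) = lam powr (\<epsilon> / 2)"
    proof -
      have "lam\<^sup>2 = lam powr 2" using E(2) by simp
      then show ?thesis unfolding E(3) by (simp only: powr_powr) simp
    qed
    finally have "sqrt (r * (\<kappa> * (l / 10)\<^sup>2)) \<le> 10 ^ 28 * A * lam powr (\<epsilon> / 2)" by simp
    then have "r * (\<kappa> * (l / 10)\<^sup>2) \<le> (10 ^ 28 * A * lam powr (\<epsilon> / 2))\<^sup>2"
      by (rule sqrt_le_D)
    also have "\<dots> = X * (lam powr (\<epsilon> / 2) * lam powr (\<epsilon> / 2))"
      by (simp only: X_def power2_eq_square mult_ac)
    also have "lam powr (\<epsilon> / 2) * lam powr (\<epsilon> / 2) = lam powr \<epsilon>" by (simp flip: powr_add)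
    finally have "lam powr (1 / 3) * (\<kappa> * l\<^sup>2) \<le> 200 * X * lam powr \<epsilon>"
      by (simp add: r_def power_divide)
    then have "lam powr (- 1 / 3) * (lam powr (1 / 3) * (\<kappa> * l\<^sup>2)) \<le> lam powr (- 1 / 3) * (200 * X * lam powr \<epsilon>)"
      by (rule mult_left_mono) simp
    also have "lam powr (- 1 / 3) * (lam powr (1 / 3) * (\<kappa> * l\<^sup>2)) = \<kappa> * l\<^sup>2"
    proof -
      have "lam powr (- 1 / 3) * lam powr (1 / 3) = 1" using E(2) by (simp flip: powr_add)
      then show ?thesis by (simp only: mult.assoc[symmetric] mult_1_left)
    qed
    also have "lam powr (- 1 / 3) * (200 * X * lam powr \<epsilon>) = K / 5 * lam powr (- 1 / 3 + \<epsilon>)"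
      by (simp only: K_def powr_add) simp
    finally have "4 * (\<kappa> * l\<^sup>2) \<le> 4 / 5 * (K * lam powr (- 1 / 3 + \<epsilon>))" by simp
    moreover have "0 < K * lam powr (- 1 / 3 + \<epsilon>)" using K E(2) by simp
    ultimately show ?thesis using wid by (simp add: mult.assoc)
  qed
  show "\<exists>K>0. \<forall>(E::nat) (lam::real) (\<phi> :: torus \<Rightarrow> real) (C :: torus set) (\<Gamma> :: (real ^ 2) set).
        E \<ge> 1 \<and> lam > 0 \<and> real E = lam\<^sup>2 \<and> eigenfunction E \<phi> \<and>
        regular_arc C \<and> C \<subseteq> nodal_set \<phi> \<and> regular_lift C \<Gamma> \<longrightarrow>
        width \<Gamma> < K * lam powr (- 1 / 3 + \<epsilon>)"
    by (intro exI[of _ K] conjI allI impI K) (elim conjE, rule bound; assumption)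
qed

end
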